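(* Let $d\ge1$ and $n\ge d+3$. Then any linear automorphism ${\bf A}$ of $L_{d,n}$ is a scalar multiple of a signed permutation induced by a vertex relabeling, i.e., ${\bf A}=c\,{\bf S}{\bf P}$ with $c\in\mathbb C\setminus\{0\}$, ${\bf S}$ diagonal with entries $\pm1$, and ${\bf P}$ a permutation matrix sending $e_{\{i,j\}}$ to $e_{\{\sigma(i),\sigma(j)\}}$ for some permutation $\sigma$ of $\{1,\dots,n\}$.
   Context: Let $N=\binom n2$ and index coordinates of $\mathbb C^N$ by edges $\{i,j\}$ of $K_n$. For a complex configuration ${\bf p}$ of $n$ points in $\mathbb C^d$, $m({\bf p})\in\mathbb C^N$ has coordinates $m_{ij}({\bf p})=\sum_{k=1}^d({\bf p}_i^k-{\bf p}_j^k)^2$ (no conjugation); $M_{d,n}$ is the image of $m$; $L_{d,n}=s^{-1}(M_{d,n})$ with $s$ the coordinatewise squaring map. A linear automorphism of $L_{d,n}$ is a non-singular $N\times N$ complex matrix mapping $L_{d,n}$ bijectively onto itself. *)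

theory Defs
  imports Complex_Main "HOL-Combinatorics.Permutations"
begin

text \<open>Vertices of K_n are 0..n-1; an edge {i,j} is the 2-element set {i,j}.
  A vector of C^N is a function from edges to complex numbers, which is zero
  off the edge set; an N x N matrix is a function edge => edge => complex,
  only whose entries on edges x edges matter.\<close>

definition edges :: "nat \<Rightarrow> nat set set" where
  "edges n = {{i, j} | i j. i < n \<and> j < n \<and> i \<noteq> j}"

definition cvec :: "nat \<Rightarrow> (nat set \<Rightarrow> complex) set" where
  "cvec n = {v. \<forall>e. e \<notin> edges n \<longrightarrow> v e = 0}"

definition meas :: "nat \<Rightarrow> nat \<Rightarrow> (nat \<Rightarrow> nat \<Rightarrow> complex) \<Rightarrow> nat set \<Rightarrow> complex" where
  "meas d n p = (\<lambda>e. if e \<in> edges n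
      then (\<Sum>k<d. (p (Min e) k - p (Max e) k)^2) else 0)"

definition Mset :: "nat \<Rightarrow> nat \<Rightarrow> (nat set \<Rightarrow> complex) set" where
  "Mset d n = range (meas d n)"

definition sqmap :: "(nat set \<Rightarrow> complex) \<Rightarrow> nat set \<Rightarrow> complex" where
  "sqmap v = (\<lambda>e. (v e)^2)"

definition Lset :: "nat \<Rightarrow> nat \<Rightarrow> (nat set \<Rightarrow> complex) set" where
  "Lset d n = {v \<in> cvec n. sqmap v \<in> Mset d n}"

definition mat_app :: "nat \<Rightarrow> (nat set \<Rightarrow> nat set \<Rightarrow> complex) \<Rightarrow> (nat set \<Rightarrow> complex) \<Rightarrow> nat set \<Rightarrow> complex" where
  "mat_app n A v = (\<lambda>e. if e \<in> edges n then (\<Sum>f\<in>edges n. A e f * v f) else 0)"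

definition mat_mult :: "nat \<Rightarrow> (nat set \<Rightarrow> nat set \<Rightarrow> complex) \<Rightarrow> (nat set \<Rightarrow> nat set \<Rightarrow> complex) \<Rightarrow> nat set \<Rightarrow> nat set \<Rightarrow> complex" where
  "mat_mult n A B = (\<lambda>e g. \<Sum>f\<in>edges n. A e f * B f g)"

definition nonsingular :: "nat \<Rightarrow> (nat set \<Rightarrow> nat set \<Rightarrow> complex) \<Rightarrow> bool" where
  "nonsingular n A \<longleftrightarrow> (\<exists>B. \<forall>e\<in>edges n. \<forall>g\<in>edges n.
      mat_mult n A B e g = (if e = g then 1 else 0) \<and>
      mat_mult n B A e g = (if e = g then 1 else 0))"

definition lin_aut :: "nat \<Rightarrow> nat \<Rightarrow> (nat set \<Rightarrow> nat set \<Rightarrow> complex) \<Rightarrow> bool" where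
  "lin_aut d n A \<longleftrightarrow> nonsingular n A \<and> mat_app n A ` Lset d n = Lset d n"

end

theory Submission
  imports Defs "Jordan_Normal_Form.Determinant"
begin

text \<open>A polynomial \<open>f\<close> of degree at most \<open>2 d + 2\<close> vanishing on \<open>L\<close> has the form \<open>g (x\<^sup>2)\<close>, because
  \<open>L\<close> is closed under sign changes and no nonzero polynomial of degree at most \<open>d\<close> vanishes on \<open>M\<close>.
  As a function of a quadratic form, such a \<open>g\<close> is affine along every square of a linear form; hence
  \<open>f\<close> has degree at most two along a signed star vector \<open>\<Sum>j. \<plusminus>e\<^bsub>ij\<^esub>\<close>: moving along it replaces
  a form \<open>y + c\<^sup>2\<close> by \<open>y + (c + t z\<^sub>i)\<^sup>2\<close>. Applied to \<open>f = \<Delta> \<circ> A\<close> with \<open>\<Delta>\<close> a minor of the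
  Gram matrix, this shows that \<open>\<Delta>\<close> has degree at most two along the image under \<open>A\<close> of a star vector.
  When \<open>n \<ge> d + 3\<close>, only multiples of star vectors have this property for all minors.
  So \<open>A\<close> permutes the lines spanned by star vectors; it permutes the stars themselves, and every edge
  is the intersection of two stars.\<close>

section \<open>Polynomial functions\<close>

text \<open>Polynomials of total degree at most \<open>k\<close> in the coordinates from
  \<open>E\<close>, taken as functions because only values and degree bounds matter.\<close>

inductive polyfun :: "'a set \<Rightarrow> nat \<Rightarrow> (('a \<Rightarrow> complex) \<Rightarrow> complex) \<Rightarrow> bool"
  for E where
  polyfun_const: "polyfun E k (\<lambda>x. c)"
| polyfun_coord_times: "e \<in> E \<Longrightarrow> polyfun E k f \<Longrightarrow> polyfun E (Suc k) (\<lambda>x. x e * f x)"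
| polyfun_add: "polyfun E k f \<Longrightarrow> polyfun E k g \<Longrightarrow> polyfun E k (\<lambda>x. f x + g x)"

lemma polyfun_cmult: "polyfun E k f \<Longrightarrow> polyfun E k (\<lambda>x. c * f x)"
proof (induction rule: polyfun.induct)
  case (polyfun_coord_times e k f)
  then show ?case
    using polyfun.polyfun_coord_times[of e E k "\<lambda>x. c * f x"] by (simp add: mult.left_commute)
qed (auto simp: distrib_left intro: polyfun.intros)

lemma polyfun_mono: "polyfun E k f \<Longrightarrow> k \<le> l \<Longrightarrow> polyfun E l f"
proof (induction arbitrary: l rule: polyfun.induct)
  case (polyfun_coord_times e k f)
  then obtain l' where "l = Suc l'" "k \<le> l'" by (cases l) auto
  with polyfun_coord_times show ?case by (auto intro: polyfun.intros)
qed (auto intro: polyfun.intros)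

lemma polyfun_mult: "polyfun E k f \<Longrightarrow> polyfun E l g \<Longrightarrow> polyfun E (k + l) (\<lambda>x. f x * g x)"
proof (induction rule: polyfun.induct)
  case (polyfun_const k c)
  show ?case by (rule polyfun_mono[OF polyfun_cmult[OF polyfun_const.prems]]) simp
next
  case (polyfun_coord_times e k f)
  then show ?case
    using polyfun.polyfun_coord_times[of e E "k + l" "\<lambda>x. f x * g x"] by (simp add: mult.assoc)
qed (auto simp: distrib_right intro: polyfun.intros)

lemma polyfun_coord: "e \<in> E \<Longrightarrow> polyfun E 1 (\<lambda>x. x e)"
  using polyfun_coord_times[OF _ polyfun_const[of E 0 1]] by simp

lemma polyfun_sub: "polyfun E k f \<Longrightarrow> polyfun E k g \<Longrightarrow> polyfun E k (\<lambda>x. f x - g x)"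
  using polyfun_add[OF _ polyfun_cmult[of E k g "-1"], of f] by simp

lemma polyfun_sum: "(\<And>i. i \<in> I \<Longrightarrow> polyfun E k (f i)) \<Longrightarrow> polyfun E k (\<lambda>x. \<Sum>i\<in>I. f i x)"
  by (induction I rule: infinite_finite_induct) (auto intro: polyfun.intros)

lemma polyfun_prod:
  "(\<And>i. i \<in> I \<Longrightarrow> polyfun E k (f i)) \<Longrightarrow> polyfun E (k * card I) (\<lambda>x. \<Prod>i\<in>I. f i x)"
proof (induction I rule: infinite_finite_induct)
  case (insert i I)
  then show ?case using polyfun_mult[of E k "f i" "k * card I"] by simp
qed (auto intro: polyfun.intros)

lemma polyfun_power2: "polyfun E 1 f \<Longrightarrow> polyfun E 2 (\<lambda>x. (f x)\<^sup>2)"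
  using polyfun_mult[of E 1 f 1 f] by (simp add: power2_eq_square numeral_2_eq_2)

lemma polyfun_shift: "polyfun E k f \<Longrightarrow> polyfun E k (\<lambda>x. f (\<lambda>a. x a + w a))"
proof (induction rule: polyfun.induct)
  case (polyfun_coord_times e k f)
  have "polyfun E (Suc k) (\<lambda>x. x e * f (\<lambda>a. x a + w a) + w e * f (\<lambda>a. x a + w a))"
    using polyfun_coord_times
    by (intro polyfun_add polyfun.polyfun_coord_times polyfun_mono[OF polyfun_cmult, of E k]) auto
  then show ?case by (simp add: distrib_right)
qed (auto intro: polyfun.intros)

text \<open>A finite difference loses one degree. At \<open>k = 0\<close> truncated subtraction
  makes the first conjunct give mere constancy; the second supplies the vanishing that the
  coordinate step needs there.\<close>

lemma polyfun_difference:
  "polyfun E k f \<Longrightarrow> polyfun E (k - 1) (\<lambda>x. f (\<lambda>a. x a + w a) - f x) \<and> (k = 0 \<longrightarrow> (\<forall>x. f (\<lambda>a. x a + w a) = f x))"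
proof (induction rule: polyfun.induct)
  case (polyfun_const k c)
  then show ?case using polyfun.polyfun_const[of E _ 0] by simp
next
  case (polyfun_coord_times e k f)
  have eq: "(x e + w e) * f (\<lambda>a. x a + w a) - x e * f x = x e * (f (\<lambda>a. x a + w a) - f x) + w e * f (\<lambda>a. x a + w a)" for x
    by (simp add: algebra_simps)
  have "polyfun E k (\<lambda>x. x e * (f (\<lambda>a. x a + w a) - f x))"
  proof (cases k)
    case 0
    then show ?thesis using polyfun_coord_times polyfun.polyfun_const[of E _ 0] by simp
  next
    case (Suc k')
    then show ?thesis using polyfun_coord_times by (auto intro: polyfun.polyfun_coord_times)
  qed
  moreover have "polyfun E k (\<lambda>x. w e * f (\<lambda>a. x a + w a))"
    using polyfun_coord_times by (intro polyfun_cmult polyfun_shift)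
  ultimately show ?case unfolding eq by (auto intro: polyfun_add)
next
  case (polyfun_add k f g)
  then show ?case
    using polyfun.polyfun_add[of E "k - 1" "\<lambda>x. f (\<lambda>a. x a + w a) - f x" "\<lambda>x. g (\<lambda>a. x a + w a) - g x"]
    by (simp add: algebra_simps)
qed

lemma polyfun_0: "polyfun E 0 f \<Longrightarrow> f x = f y"
  using polyfun_difference[of E 0 f "\<lambda>a. x a - y a"] by (auto dest: spec[of _ y])

lemma polyfun_cong:
  "polyfun E k f \<Longrightarrow> (\<And>e. e \<in> E \<Longrightarrow> x e = y e) \<Longrightarrow> f x = f y"
  by (induction rule: polyfun.induct) auto

lemma polyfun_along_curve:
  "polyfun E k f \<Longrightarrow> (\<And>e. e \<in> E \<Longrightarrow> \<exists>q. \<forall>t. x t e = poly q t) \<Longrightarrow> \<exists>q. \<forall>t. f (x t) = poly q t"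
proof (induction rule: polyfun.induct)
  case (polyfun_const k c)
  show ?case by (rule exI[of _ "[:c:]"]) simp
next
  case (polyfun_coord_times e k f)
  then obtain q r where "\<forall>t. x t e = poly q t" "\<forall>t. f (x t) = poly r t" by blast
  then show ?case by (intro exI[of _ "q * r"]) simp
next
  case (polyfun_add k f g)
  then obtain q r where "\<forall>t. g (x t) = poly q t" "\<forall>t. f (x t) = poly r t" by blast
  then show ?case by (intro exI[of _ "r + q"]) simp
qed

text \<open>Each monomial is a squarefree monomial over a set \<open>S\<close> times a monomial in
  the squares; \<open>g S\<close> collects the second factors. For \<open>card S\<close> above
  \<open>k\<close>, truncated subtraction would still allow a constant, so vanishing is stated
  separately.\<close>

lemma polyfun_parity_decomposition:
  assumes "finite E" "polyfun E k f"
  shows "\<exists>g. (\<forall>S\<subseteq>E. if card S \<le> k then polyfun E ((k - card S) div 2) (g S) else g S = (\<lambda>y. 0)) \<and>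
             (\<forall>x. f x = (\<Sum>S\<in>Pow E. (\<Prod>e\<in>S. x e) * g S (\<lambda>e. (x e)\<^sup>2)))"
  using assms(2)
proof (induction rule: polyfun.induct)
  case (polyfun_const k c)
  have "(\<Sum>S\<in>Pow E. (\<Prod>e\<in>S. x e) * (if S = {} then c else 0)) = c" for x :: "'a \<Rightarrow> complex"
  proof -
    have "(\<Sum>S\<in>Pow E. (\<Prod>e\<in>S. x e) * (if S = {} then c else 0)) = (\<Sum>S\<in>{{}}. (\<Prod>e\<in>S. x e) * c)"
      using assms(1) by (intro sum.mono_neutral_cong_right) auto
    then show ?thesis by simp
  qed
  then show ?case
    by (intro exI[of _ "\<lambda>S y. if S = {} then c else 0"])
       (simp add: polyfun.polyfun_const)
next
  case (polyfun_coord_times e k f)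
  from polyfun_coord_times.IH obtain g where
    g: "\<forall>S\<subseteq>E. if card S \<le> k then polyfun E ((k - card S) div 2) (g S) else g S = (\<lambda>y. 0)"
    and f: "\<forall>x. f x = (\<Sum>S\<in>Pow E. (\<Prod>e\<in>S. x e) * g S (\<lambda>e. (x e)\<^sup>2))"
    by (elim exE conjE) (rule that)
  \<comment> \<open>Multiplication by \<open>x e\<close> toggles \<open>e\<close> in
    \<open>S\<close>; where \<open>e\<close> is removed, a factor \<open>(x e)\<^sup>2\<close> is
    left over, which becomes \<open>y e\<close>.\<close>
  define h where "h = (\<lambda>S y. if e \<in> S then g (S - {e}) y else y e * g (insert e S) y)"
  have "x e * f x = (\<Sum>S\<in>Pow E. (\<Prod>e\<in>S. x e) * h S (\<lambda>e. (x e)\<^sup>2))" for x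
    unfolding f[rule_format] sum_distrib_left
  proof (rule sum.reindex_bij_witness[where i = "\<lambda>S. if e \<in> S then S - {e} else insert e S"
        and j = "\<lambda>S. if e \<in> S then S - {e} else insert e S"], goal_cases)
    case (5 S)
    then have fin: "finite S" using assms(1) finite_subset by auto
    show ?case
    proof (cases "e \<in> S")
      case True
      then have "(\<Prod>e\<in>S. x e) = x e * (\<Prod>e\<in>S - {e}. x e)" using fin by (simp add: prod.remove)
      then show ?thesis using True by (simp add: h_def insert_absorb power2_eq_square)
    next
      case False
      then show ?thesis using fin by (simp add: h_def)
    qed
  qed (use polyfun_coord_times(1) in auto)
  moreover have "if card S \<le> Suc k then polyfun E ((Suc k - card S) div 2) (h S) else h S = (\<lambda>y. 0)"
    if S: "S \<subseteq> E" for S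
  proof (cases "e \<in> S")
    case True
    define m where "m = card (S - {e})"
    have c: "card S = Suc m"
      using True S assms(1) unfolding m_def by (metis card.remove finite_subset)
    have "S - {e} \<subseteq> E" using S by auto
    from g[rule_format, OF this, folded m_def] show ?thesis using c True by (simp add: h_def)
  next
    case False
    have c: "card (insert e S) = Suc (card S)"
      using False S assms(1) by (simp add: finite_subset)
    have ins: "insert e S \<subseteq> E" using S polyfun_coord_times(1) by simp
    show ?thesis
    proof (cases "Suc (card S) \<le> k")
      case True
      then obtain m where m: "k = Suc (card S) + m" using le_Suc_ex by blast
      have "polyfun E (Suc (m div 2)) (\<lambda>y. y e * g (insert e S) y)"
        using g[rule_format, OF ins] c True m polyfun_coord_times(1) by (intro polyfun.polyfun_coord_times) auto
      moreover have "Suc (m div 2) = (Suc k - card S) div 2" using m by simp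
      moreover have "h S = (\<lambda>y. y e * g (insert e S) y)" using False by (simp add: h_def)
      ultimately have "polyfun E ((Suc k - card S) div 2) (h S)" by (simp only:)
      then show ?thesis using True by simp
    next
      case big: False
      then have "g (insert e S) = (\<lambda>y. 0)" using g[rule_format, OF ins] c by simp
      then have "h S = (\<lambda>y. 0)" using False by (simp add: h_def)
      then show ?thesis using polyfun.polyfun_const[of E _ 0] by simp
    qed
  qed
  ultimately show ?case by (intro exI[of _ h]) auto
next
  case (polyfun_add k f f')
  from polyfun_add.IH(1) obtain g where
    g: "\<forall>S\<subseteq>E. if card S \<le> k then polyfun E ((k - card S) div 2) (g S) else g S = (\<lambda>y. 0)"
    "\<forall>x. f x = (\<Sum>S\<in>Pow E. (\<Prod>e\<in>S. x e) * g S (\<lambda>e. (x e)\<^sup>2))"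
    by (elim exE conjE) (rule that)
  from polyfun_add.IH(2) obtain h where
    h: "\<forall>S\<subseteq>E. if card S \<le> k then polyfun E ((k - card S) div 2) (h S) else h S = (\<lambda>y. 0)"
    "\<forall>x. f' x = (\<Sum>S\<in>Pow E. (\<Prod>e\<in>S. x e) * h S (\<lambda>e. (x e)\<^sup>2))"
    by (elim exE conjE) (rule that)
  have "if card S \<le> k then polyfun E ((k - card S) div 2) (\<lambda>y. g S y + h S y)
        else (\<lambda>y. g S y + h S y) = (\<lambda>y. 0)" if "S \<subseteq> E" for S
    using g(1)[rule_format, OF that] h(1)[rule_format, OF that] polyfun.polyfun_add by auto
  then show ?case
    by (intro exI[of _ "\<lambda>S y. g S y + h S y"]) (auto simp: g(2) h(2) sum.distrib distrib_left)
qed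

text \<open>Linear independence of the characters of the group of sign vectors. Comparing both signs
  of the new element separates \<open>h S\<close> from \<open>h (insert a S)\<close>.\<close>

lemma sign_characters_independent:
  fixes h :: "'a set \<Rightarrow> complex"
  assumes "finite E"
    and "\<And>\<epsilon>. (\<forall>e. \<epsilon> e = 1 \<or> \<epsilon> e = -1) \<Longrightarrow> (\<Sum>S\<in>Pow E. (\<Prod>e\<in>S. \<epsilon> e) * h S) = 0"
  shows "\<forall>S\<subseteq>E. h S = 0"
  using assms
proof (induction E arbitrary: h rule: finite_induct)
  case empty
  then show ?case using empty.prems[of "\<lambda>_. 1"] by simp
next
  case (insert a E)
  have pm: "h S + c * h (insert a S) = 0" if "S \<subseteq> E" and c: "c = 1 \<or> c = -1" for S c
  proof -
    have "(\<Sum>S\<in>Pow E. (\<Prod>e\<in>S. \<epsilon> e) * (h S + c * h (insert a S))) = 0"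
      if e: "\<forall>e. \<epsilon> e = 1 \<or> \<epsilon> e = -1" for \<epsilon> :: "'a \<Rightarrow> complex"
    proof -
      let ?e = "\<epsilon>(a := c)"
      have inj: "inj_on (insert a) (Pow E)" using insert(2) by (auto simp: inj_on_def)
      have p: "(\<Prod>e\<in>S. ?e e) = (\<Prod>e\<in>S. \<epsilon> e)" if "S \<subseteq> E" for S
        using that insert(2) by (intro prod.cong) auto
      have q: "(\<Prod>e\<in>insert a S. ?e e) = c * (\<Prod>e\<in>S. \<epsilon> e)" if "S \<subseteq> E" for S
        using that insert(1,2) p[OF that] by (subst prod.insert) (auto intro: finite_subset)
      have "0 = (\<Sum>S\<in>Pow (insert a E). (\<Prod>e\<in>S. ?e e) * h S)"
        using e c by (intro insert.prems[symmetric]) auto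
      also have "\<dots> = (\<Sum>S\<in>Pow E. (\<Prod>e\<in>S. ?e e) * h S) + (\<Sum>S\<in>insert a ` Pow E. (\<Prod>e\<in>S. ?e e) * h S)"
        unfolding Pow_insert using insert(1,2) by (intro sum.union_disjoint) auto
      also have "\<dots> = (\<Sum>S\<in>Pow E. (\<Prod>e\<in>S. \<epsilon> e) * h S) + (\<Sum>S\<in>Pow E. c * (\<Prod>e\<in>S. \<epsilon> e) * h (insert a S))"
        unfolding sum.reindex[OF inj] o_def
        by (intro arg_cong2[of _ _ _ _ "(+)"] sum.cong) (auto simp only: p q Pow_iff)
      finally show ?thesis by (simp add: sum.distrib[symmetric] algebra_simps)
    qed
    from insert.IH[OF this] that show ?thesis by auto
  qed
  have *: "h S = 0 \<and> h (insert a S) = 0" if "S \<subseteq> E" for S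
    using pm[OF that, of 1] pm[OF that, of "-1"] by auto
  show ?case
  proof (intro allI impI)
    fix S assume "S \<subseteq> insert a E"
    then have "S - {a} \<subseteq> E" by auto
    from *[OF this] show "h S = 0" by (cases "a \<in> S") (auto simp: insert_absorb)
  qed
qed

section \<open>Polynomials vanishing on the measurement sets\<close>

lemma poly_eq_if_eq_on_nats:
  fixes p q :: "complex poly"
  assumes "\<And>m. m > 0 \<Longrightarrow> poly p (of_nat m) = poly q (of_nat m)"
  shows "p = q"
proof (rule ccontr)
  assume "p \<noteq> q"
  then have "finite {x. poly (p - q) x = 0}" by (intro poly_roots_finite) simp
  moreover have "range (\<lambda>m. of_nat (Suc m) :: complex) \<subseteq> {x. poly (p - q) x = 0}"
    using assms by (auto simp del: of_nat_Suc)
  moreover have "infinite (range (\<lambda>m. of_nat (Suc m) :: complex))"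
    by (intro range_inj_infinite) (auto simp: inj_on_def)
  ultimately show False using finite_subset by blast
qed

lemma pair_in_edges [simp]: "{i, j} \<in> edges n \<longleftrightarrow> i < n \<and> j < n \<and> i \<noteq> j"
  by (auto simp: edges_def doubleton_eq_iff)

lemma singleton_notin_edges [simp]: "{i} \<notin> edges n"
  by (auto simp: edges_def)

lemma edgesE:
  assumes "e \<in> edges n"
  obtains i j where "e = {i, j}" "i < n" "j < n" "i \<noteq> j"
  using assms by (auto simp: edges_def)

lemma edges_containE:
  assumes "e \<in> edges n" "i \<in> e"
  obtains k where "e = {i, k}" "k < n" "k \<noteq> i"
proof -
  from assms(1) obtain a b where "e = {a, b}" "a < n" "b < n" "a \<noteq> b" by (rule edgesE)
  with assms(2) that[of a] that[of b] show ?thesis by (auto simp: insert_commute)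
qed

lemma finite_edges [simp]: "finite (edges n)"
  by (rule finite_subset[of _ "Pow {..<n}"]) (auto simp: edges_def)

text \<open>The measurement vector of a configuration \<open>a\<close> on a line: the square of a
  linear form, when C^N is read as a space of quadratic forms.\<close>

definition sqd :: "nat \<Rightarrow> (nat \<Rightarrow> complex) \<Rightarrow> nat set \<Rightarrow> complex" where
  "sqd n a = (\<lambda>e. if e \<in> edges n then (a (Min e) - a (Max e))\<^sup>2 else 0)"

lemma sqd_pair: "i < n \<Longrightarrow> j < n \<Longrightarrow> sqd n a {i, j} = (a i - a j)\<^sup>2"
  by (auto simp: sqd_def min_def max_def power2_commute)

lemma sqd_scale: "sqd n (\<lambda>i. r * a i) e = r\<^sup>2 * sqd n a e"
  by (simp add: sqd_def power_mult_distrib flip: right_diff_distrib)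

lemma meas_pair: "i < n \<Longrightarrow> j < n \<Longrightarrow> meas d n p {i, j} = (\<Sum>k<d. (p i k - p j k)\<^sup>2)"
  by (auto simp: meas_def min_def max_def power2_commute intro: sum.cong)

lemma Mset_add:
  assumes "y \<in> Mset d n"
  shows "(\<lambda>e. y e + s * sqd n a e) \<in> Mset (Suc d) n"
proof -
  from assms obtain p where p: "y = meas d n p" by (auto simp: Mset_def)
  have "(\<lambda>e. y e + s * sqd n a e) = meas (Suc d) n (\<lambda>i k. if k = d then csqrt s * a i else p i k)"
    by (auto simp: p meas_def sqd_def power_mult_distrib simp flip: right_diff_distrib intro!: ext sum.cong)
  then show ?thesis by (simp add: Mset_def)
qed

lemma Mset_Suc: "y \<in> Mset d n \<Longrightarrow> y \<in> Mset (Suc d) n"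
  using Mset_add[of y d n 0] by simp

lemma Mset_0: "Mset 0 n = {\<lambda>_. 0}"
  by (auto simp: Mset_def meas_def fun_eq_iff)

text \<open>Differences of \<open>g\<close> along squares have smaller degree and vanish on the
  measurement set one dimension lower, hence everywhere by induction. So \<open>g\<close> is
  invariant under adding multiples of squares; these span, and \<open>g\<close> is constant with
  value 0 at the origin.\<close>

lemma polyfun_vanishing_on_Mset:
  assumes "polyfun (edges n) k g" "k \<le> d" "\<And>y. y \<in> Mset d n \<Longrightarrow> g y = 0"
  shows "g y = 0"
  using assms
proof (induction d arbitrary: k g y)
  case 0
  then show ?case using polyfun_0[of "edges n" g y "\<lambda>_. 0"] by (simp add: Mset_0)
next
  case (Suc d)
  have inv: "g (\<lambda>e. y e + s * sqd n a e) = g y" for y s a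
  proof -
    have "g (\<lambda>e. y e + s * sqd n a e) - g y = 0"
    proof (rule Suc.IH[of "k - 1" "\<lambda>y. g (\<lambda>e. y e + s * sqd n a e) - g y"])
      show "polyfun (edges n) (k - 1) (\<lambda>y. g (\<lambda>e. y e + s * sqd n a e) - g y)"
        using polyfun_difference[OF Suc.prems(1), of "\<lambda>e. s * sqd n a e"] by blast
      show "k - 1 \<le> d" using Suc.prems(2) by simp
    qed (use Suc.prems(3) Mset_add Mset_Suc in auto)
    then show ?thesis by simp
  qed
  \<comment> \<open>Polarization: the cut vectors of \<open>{i}\<close> and \<open>{j}\<close> minus
    that of \<open>{i, j}\<close> give twice the unit vector of the edge.\<close>
  have unit: "g (\<lambda>f. y f + s * (if f = e then 1 else 0)) = g y" if ed: "e \<in> edges n" for y s e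
  proof -
    obtain i j where e: "e = {i, j}" "i < n" "j < n" "i \<noteq> j" using edgesE[OF ed] .
    let ?I = "\<lambda>A k. if k \<in> A then 1 else 0 :: complex"
    have "s * (if f = e then 1 else 0)
        = s/2 * sqd n (?I {i}) f + s/2 * sqd n (?I {j}) f + (- s/2) * sqd n (?I {i, j}) f" for f
    proof (cases "f \<in> edges n")
      case True
      then obtain k l where "f = {k, l}" "k < n" "l < n" "k \<noteq> l" by (rule edgesE)
      then show ?thesis using e by (auto simp: sqd_pair doubleton_eq_iff)
    qed (use ed in \<open>auto simp: sqd_def\<close>)
    then have "(\<lambda>f. y f + s * (if f = e then 1 else 0))
        = (\<lambda>f. y f + s/2 * sqd n (?I {i}) f + s/2 * sqd n (?I {j}) f + (- s/2) * sqd n (?I {i, j}) f)"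
      by (simp only: add.assoc)
    then show ?thesis by (simp only: inv)
  qed
  have "g (\<lambda>e. if e \<in> F then y e else 0) = g (\<lambda>_. 0)" if "finite F" "F \<subseteq> edges n" for F
    using that
  proof (induction F rule: finite_induct)
    case (insert e F)
    have "(\<lambda>f. if f \<in> insert e F then y f else 0)
        = (\<lambda>f. (if f \<in> F then y f else 0) + y e * (if f = e then 1 else 0))"
      using insert.hyps by auto
    then have "g (\<lambda>f. if f \<in> insert e F then y f else 0) = g (\<lambda>f. if f \<in> F then y f else 0)"
      using unit insert.prems by (simp only: insert_subset)
    then show ?case using insert by simp
  qed simp
  from this[of "edges n"] have "g (\<lambda>e. if e \<in> edges n then y e else 0) = g (\<lambda>_. 0)" by simp
  moreover have "g (\<lambda>e. if e \<in> edges n then y e else 0) = g y"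
    using Suc.prems(1) by (rule polyfun_cong) simp
  moreover have "meas (Suc d) n (\<lambda>_ _. 0) = (\<lambda>_. 0)" by (simp add: meas_def fun_eq_iff)
  then have "(\<lambda>_. 0) \<in> Mset (Suc d) n" unfolding Mset_def by (metis rangeI)
  ultimately show ?case using Suc.prems(3) by simp
qed

text \<open>The mixed second difference along one square has degree at most \<open>d - 1\<close> and
  vanishes on the measurement set of dimension \<open>d - 1\<close>, because both steps together
  still add a single square. So it is zero: the increment is additive in \<open>s\<close> and, being
  polynomial, linear.\<close>

lemma affine_along_squares:
  assumes g: "polyfun (edges n) (Suc d) g" and "d \<ge> 1" and M: "\<And>y. y \<in> Mset d n \<Longrightarrow> g y = 0"
  shows "g (\<lambda>e. y e + s * sqd n a e) = g y + s * (g (\<lambda>e. y e + sqd n a e) - g y)"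
proof -
  obtain d' where d: "d = Suc d'" using \<open>d \<ge> 1\<close> by (cases d) auto
  have add: "g (\<lambda>e. y e + (r + s) * sqd n a e) - g y
      = (g (\<lambda>e. y e + r * sqd n a e) - g y) + (g (\<lambda>e. y e + s * sqd n a e) - g y)" for r s
  proof -
    let ?h = "\<lambda>y. g (\<lambda>e. y e + s * sqd n a e) - g y"
    have "?h (\<lambda>e. y e + r * sqd n a e) - ?h y = 0"
    proof (rule polyfun_vanishing_on_Mset[where g = "\<lambda>y. ?h (\<lambda>e. y e + r * sqd n a e) - ?h y"])
      have "polyfun (edges n) d ?h" using polyfun_difference[OF g, of "\<lambda>e. s * sqd n a e"] by simp
      from polyfun_difference[OF this, of "\<lambda>e. r * sqd n a e"]
      show "polyfun (edges n) d' (\<lambda>y. ?h (\<lambda>e. y e + r * sqd n a e) - ?h y)" by (simp add: d)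
      show "d' \<le> d'" ..
      fix y assume y: "y \<in> Mset d' n"
      have "(\<lambda>e. y e + r * sqd n a e + s * sqd n a e) \<in> Mset d n"
        using Mset_add[OF y, of "r + s" a] by (simp add: d algebra_simps)
      then show "?h (\<lambda>e. y e + r * sqd n a e) - ?h y = 0"
        using Mset_add[OF y] Mset_Suc[OF y] M by (simp add: d)
    qed
    then show ?thesis by (simp add: algebra_simps)
  qed
  define b where "b = g (\<lambda>e. y e + sqd n a e) - g y"
  have nat: "g (\<lambda>e. y e + of_nat m * sqd n a e) - g y = of_nat m * b" for m
  proof (induction m)
    case (Suc m)
    have "of_nat (Suc m) = of_nat m + (1 :: complex)" by simp
    then show ?case by (simp only: add Suc) (simp add: b_def distrib_right)
  qed simp
  have "\<exists>q. \<forall>t. y e + t * sqd n a e = poly q t" for e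
    by (rule exI[of _ "[:y e, sqd n a e:]"]) simp
  then obtain q where q: "\<And>t. g (\<lambda>e. y e + t * sqd n a e) = poly q t"
    using polyfun_along_curve[OF g, of "\<lambda>t e. y e + t * sqd n a e"] by blast
  have "q = [:g y, b:]"
    using nat by (intro poly_eq_if_eq_on_nats) (simp add: q[symmetric] algebra_simps)
  then show ?thesis using q[of s] by (simp add: b_def)
qed

text \<open>Affinity along squares makes \<open>a \<mapsto> g (y + a\<^sup>2) - g y\<close> homogeneous of degree two,
  so it grows at most quadratically along any line.\<close>

lemma quadratic_along_squared_lines:
  assumes g: "polyfun (edges n) (Suc d) g" and "d \<ge> 1" and M: "\<And>y. y \<in> Mset d n \<Longrightarrow> g y = 0"
  shows "\<exists>q. degree q \<le> 2 \<and> (\<forall>t. g (\<lambda>e. y e + sqd n (\<lambda>i. c i + t * a i) e) = poly q t)"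
proof -
  define h where "h = (\<lambda>v. g (\<lambda>e. y e + sqd n v e) - g y)"
  have hom: "h (\<lambda>i. r * v i) = r\<^sup>2 * h v" for r v
    using affine_along_squares[OF assms, of y "r\<^sup>2" v] by (simp add: h_def sqd_scale)
  have curve: "\<exists>q. \<forall>t. h (\<lambda>i. u i + t * v i) = poly q t" for u v
  proof -
    have "\<exists>q. \<forall>t. y e + sqd n (\<lambda>i. u i + t * v i) e = poly q t" for e
      by (rule exI[of _ "[:y e:] + (if e \<in> edges n then [:u (Min e) - u (Max e), v (Min e) - v (Max e):]\<^sup>2 else 0)"])
         (auto simp: sqd_def algebra_simps)
    then obtain q where "\<forall>t. g (\<lambda>e. y e + sqd n (\<lambda>i. u i + t * v i) e) = poly q t"
      using polyfun_along_curve[OF g, of "\<lambda>t e. y e + sqd n (\<lambda>i. u i + t * v i) e"] by blast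
    then show ?thesis by (intro exI[of _ "q - [:g y:]"]) (simp add: h_def)
  qed
  obtain q where q: "\<And>t. h (\<lambda>i. c i + t * a i) = poly q t" using curve by blast
  obtain p where p: "\<And>t. h (\<lambda>i. a i + t * c i) = poly p t" using curve by blast
  \<comment> \<open>Homogeneity exchanges the roles of \<open>a\<close> and \<open>c\<close>: up to
    the factor \<open>t\<^sup>2\<close>, \<open>q\<close> at \<open>t\<close> is \<open>p\<close> at
    \<open>1 / t\<close>. Clearing denominators with \<open>reflect_poly\<close> then bounds the
    degree of \<open>q\<close> by two.\<close>
  have qp: "poly q t = t\<^sup>2 * poly p (inverse t)" if "t \<noteq> 0" for t
  proof -
    have "(\<lambda>i. c i + t * a i) = (\<lambda>i. t * (a i + inverse t * c i))"
      using that by (auto simp: field_simps)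
    then show ?thesis unfolding q[symmetric] p[symmetric] using hom[of t] by (simp only:)
  qed
  have eq: "Polynomial.monom 1 (degree p) * q = Polynomial.monom 1 2 * reflect_poly p"
    by (intro poly_eq_if_eq_on_nats) (simp add: poly_monom poly_reflect_poly_nz qp)
  have "degree q \<le> 2"
  proof (cases "q = 0")
    case False
    then have "degree p + degree q = degree (Polynomial.monom 1 (degree p) * q)"
      by (simp add: degree_mult_eq degree_monom_eq)
    also have "\<dots> \<le> 2 + degree p"
      unfolding eq using degree_reflect_poly_le[of p] degree_mult_le[of "Polynomial.monom 1 2" "reflect_poly p"]
      by (simp add: degree_monom_eq)
    finally show ?thesis by simp
  qed simp
  then show ?thesis using q
    by (intro exI[of _ "q + [:g y:]"]) (auto simp: h_def algebra_simps intro: degree_add_le)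
qed

section \<open>Polynomials vanishing on L and their degree along star vectors\<close>

lemma Lset_sign_closed:
  assumes "v \<in> Lset d n" "\<And>e. \<epsilon> e = 1 \<or> \<epsilon> e = (-1::complex)"
  shows "(\<lambda>e. \<epsilon> e * v e) \<in> Lset d n"
proof -
  have "(\<epsilon> e)\<^sup>2 = 1" for e using assms(2)[of e] by auto
  then have "sqmap (\<lambda>e. \<epsilon> e * v e) = sqmap v" by (simp add: sqmap_def power_mult_distrib)
  then show ?thesis using assms(1) by (simp add: Lset_def cvec_def)
qed

lemma csqrt_meas_in_Lset: "(\<lambda>e. csqrt (meas d n p e)) \<in> Lset d n"
  by (auto simp: Lset_def cvec_def sqmap_def Mset_def meas_def)

text \<open>A substitute for irreducibility of the measurement set. On the line from
  \<open>p\<close> to the configuration with vertex \<open>i\<close> at \<open>(i, ..., i)\<close>,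
  where no length is zero, every length is a nonzero polynomial in the parameter and can be
  cancelled.\<close>

lemma polyfun_zero_if_times_lengths_zero:
  assumes "d \<ge> 1" "S \<subseteq> edges n" "polyfun (edges n) k g"
    and 0: "\<And>p. (\<Prod>e\<in>S. meas d n p e) * g (meas d n p) = 0"
  shows "g (meas d n p) = 0"
proof -
  let ?p = "\<lambda>t i k. (1 - t) * p i k + t * of_nat i"
  define m where "m = (\<lambda>e. if e \<in> edges n then (\<Sum>k<d. [:p (Min e) k - p (Max e) k,
      of_nat (Min e) - of_nat (Max e) - (p (Min e) k - p (Max e) k):]\<^sup>2) else 0)"
  have m: "meas d n (?p t) e = poly (m e) t" for t e
    by (auto simp: m_def meas_def poly_sum algebra_simps intro!: sum.cong)
  then obtain q where q: "\<And>t. g (meas d n (?p t)) = poly q t"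
    using polyfun_along_curve[OF assms(3), of "\<lambda>t. meas d n (?p t)"] by blast
  have "poly (prod m S * q) t = 0" for t
    using 0[of "?p t"] by (simp add: poly_prod m q)
  then have "prod m S * q = 0" using poly_all_0_iff_0 by blast
  moreover have "m e \<noteq> 0" if eS: "e \<in> S" for e
  proof -
    obtain i j where e: "e = {i, j}" "i < n" "j < n" "i \<noteq> j"
      using edgesE[of e n] eS assms(2) by blast
    have "poly (m e) 1 = of_nat d * (of_nat i - of_nat j)\<^sup>2"
      unfolding m[symmetric] e(1) using e by (subst meas_pair) auto
    then show ?thesis using \<open>d \<ge> 1\<close> e by auto
  qed
  ultimately have "q = 0" using finite_subset[OF assms(2)] by auto
  then show ?thesis using q[of 0] by simp
qed

lemma vanishing_on_Lset_factors_through_squares: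
  assumes "polyfun (edges n) (2 * d + 2) f" "d \<ge> 1" and L: "\<And>v. v \<in> Lset d n \<Longrightarrow> f v = 0"
  obtains g where "polyfun (edges n) (Suc d) g" "\<And>y. y \<in> Mset d n \<Longrightarrow> g y = 0"
    "\<And>x. f x = g (\<lambda>e. (x e)\<^sup>2)"
proof -
  define deg where "deg S = (2 * d + 2 - card S) div 2" for S :: "nat set set"
  obtain G where
    G: "\<forall>S\<subseteq>edges n. if card S \<le> 2 * d + 2 then polyfun (edges n) (deg S) (G S) else G S = (\<lambda>y. 0)"
    and f: "\<forall>x. f x = (\<Sum>S\<in>Pow (edges n). (\<Prod>e\<in>S. x e) * G S (\<lambda>e. (x e)\<^sup>2))"
    using polyfun_parity_decomposition[OF finite_edges assms(1), folded deg_def]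
    by (elim exE conjE) (rule that)
  have G': "polyfun (edges n) (deg S) (G S)" if "S \<subseteq> edges n" for S
    using G[rule_format, OF that] polyfun_const[of "edges n" "deg S" 0] by (simp split: if_splits)
  have van: "G S (meas d n p) = 0" if S: "S \<subseteq> edges n" for S p
  proof (rule polyfun_zero_if_times_lengths_zero[OF \<open>d \<ge> 1\<close> S G'[OF S]])
    fix p
    let ?v = "\<lambda>e. csqrt (meas d n p e)"
    \<comment> \<open>All sign changes of \<open>?v\<close> stay in L, so the decomposition of
      \<open>f\<close> becomes a vanishing combination of sign characters, and each summand is
      zero.\<close>
    have "(\<Sum>S\<in>Pow (edges n). (\<Prod>e\<in>S. \<epsilon> e) * ((\<Prod>e\<in>S. ?v e) * G S (meas d n p))) = 0"
      if e: "\<forall>e. \<epsilon> e = 1 \<or> \<epsilon> e = -1" for \<epsilon>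
    proof -
      have "(\<epsilon> e)\<^sup>2 = 1" for e using e[rule_format, of e] by auto
      then have "f (\<lambda>e. \<epsilon> e * ?v e) = (\<Sum>S\<in>Pow (edges n). (\<Prod>e\<in>S. \<epsilon> e) * ((\<Prod>e\<in>S. ?v e) * G S (meas d n p)))"
        by (simp add: f power_mult_distrib prod.distrib mult.assoc)
      then show ?thesis using L[OF Lset_sign_closed[OF csqrt_meas_in_Lset]] e by simp
    qed
    from sign_characters_independent[OF finite_edges this] S
    have "(\<Prod>e\<in>S. ?v e) * G S (meas d n p) = 0" by blast
    then show "(\<Prod>e\<in>S. meas d n p e) * G S (meas d n p) = 0"
      by (auto simp: prod_zero_iff finite_subset[OF S])
  qed
  have zero: "G S y = 0" if S: "S \<subseteq> edges n" "S \<noteq> {}" for S y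
  proof (rule polyfun_vanishing_on_Mset[OF G'[OF S(1)]])
    \<comment> \<open>A nonempty \<open>S\<close> uses at least one of the \<open>2 * d + 2\<close>
      degrees, so halving leaves at most \<open>d\<close>. For \<open>S = {}\<close> the bound is
      \<open>d + 1\<close>, and \<open>G {}\<close> survives.\<close>
    have "card S > 0" using S by (simp add: card_gt_0_iff finite_subset[OF S(1)])
    then show "deg S \<le> d" by (simp add: deg_def)
  qed (use van[OF S(1)] in \<open>auto simp: Mset_def\<close>)
  show ?thesis
  proof (rule that[of "G {}"])
    show "polyfun (edges n) (Suc d) (G {})" using G'[of "{}"] by (simp add: deg_def)
    show "G {} y = 0" if "y \<in> Mset d n" for y using that van[of "{}"] by (auto simp: Mset_def)
    fix x
    have "f x = (\<Sum>S\<in>{{}}. (\<Prod>e\<in>S. x e) * G S (\<lambda>e. (x e)\<^sup>2))"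
      unfolding f[rule_format] by (rule sum.mono_neutral_right) (use zero in auto)
    then show "f x = G {} (\<lambda>e. (x e)\<^sup>2)" by simp
  qed
qed

text \<open>Vanishes for all \<open>x\<close> when \<open>f\<close> has degree at most two in direction \<open>u\<close>.\<close>

definition third_difference ::
  "((nat set \<Rightarrow> complex) \<Rightarrow> complex) \<Rightarrow> (nat set \<Rightarrow> complex) \<Rightarrow> (nat set \<Rightarrow> complex) \<Rightarrow> complex" where
  "third_difference f x u =
     f (\<lambda>e. x e + 3 * u e) - 3 * f (\<lambda>e. x e + 2 * u e) + 3 * f (\<lambda>e. x e + u e) - f x"

text \<open>Nonzero multiples of signed star vectors; prescribing only squares admits all sign
  patterns at once.\<close>

definition star :: "nat \<Rightarrow> nat \<Rightarrow> (nat set \<Rightarrow> complex) set" where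
  "star n i = {u \<in> cvec n. \<exists>c. c \<noteq> 0 \<and> (\<forall>e\<in>edges n. (u e)\<^sup>2 = (if i \<in> e then c\<^sup>2 else 0))}"

lemma third_difference_star:
  assumes "polyfun (edges n) (2 * d + 2) f" "d \<ge> 1" "\<And>v. v \<in> Lset d n \<Longrightarrow> f v = 0"
    and "u \<in> star n i" "i < n"
  shows "third_difference f x u = 0"
proof -
  obtain g where g: "polyfun (edges n) (Suc d) g" "\<And>y. y \<in> Mset d n \<Longrightarrow> g y = 0"
    and f: "\<And>x. f x = g (\<lambda>e. (x e)\<^sup>2)"
    using vanishing_on_Lset_factors_through_squares[OF assms(1-3)] by blast
  obtain c where c: "c \<noteq> 0" "\<And>e. e \<in> edges n \<Longrightarrow> (u e)\<^sup>2 = (if i \<in> e then c\<^sup>2 else 0)"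
    using assms(4) by (auto simp: star_def)
  \<comment> \<open>Completing the square: on an edge \<open>{i, k}\<close> the difference
    \<open>w i - w k\<close> is \<open>x {i, k} * u {i, k} / c\<close>. Moving vertex
    \<open>i\<close> by \<open>t * c\<close> therefore changes \<open>sqd n w\<close> by exactly the
    change of \<open>(x e)\<^sup>2\<close>.\<close>
  define w where "w = (\<lambda>k. if k = i then 0 else - (x {i, k} * u {i, k} / c))"
  define a where "a = (\<lambda>k. if k = i then c else 0)"
  have sq: "(x e + t * u e)\<^sup>2 = ((x e)\<^sup>2 - sqd n w e) + sqd n (\<lambda>k. w k + t * a k) e"
    if ed: "e \<in> edges n" for e t
  proof (cases "i \<in> e")
    case True
    obtain k where k: "e = {i, k}" "k < n" "k \<noteq> i"
      using edges_containE[OF ed True] .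
    have u2: "(u e)\<^sup>2 = c\<^sup>2" using c(2)[OF ed] True by simp
    have "sqd n w e = (x e * u e / c)\<^sup>2"
      using k \<open>i < n\<close> by (simp add: sqd_pair w_def)
    moreover have "sqd n (\<lambda>k. w k + t * a k) e = (t * c + x e * u e / c)\<^sup>2"
      using k \<open>i < n\<close> by (simp add: sqd_pair w_def a_def)
    moreover have "(t * c + x e * u e / c)\<^sup>2 = t\<^sup>2 * c\<^sup>2 + 2 * t * x e * u e + (x e * u e / c)\<^sup>2"
      using c(1) by (simp add: field_simps power2_eq_square)
    moreover have "(x e + t * u e)\<^sup>2 = (x e)\<^sup>2 + 2 * t * x e * u e + t\<^sup>2 * c\<^sup>2"
      by (simp add: power2_sum power_mult_distrib u2)
    ultimately show ?thesis by simp
  next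
    case False
    then have "u e = 0" using c(2)[OF ed] by simp
    moreover have "sqd n w e = sqd n (\<lambda>k. w k + t * a k) e"
      using ed False by (auto elim!: edgesE simp: sqd_pair a_def)
    ultimately show ?thesis by simp
  qed
  obtain q where "degree q \<le> 2"
    and q: "\<And>t. g (\<lambda>e. ((x e)\<^sup>2 - sqd n w e) + sqd n (\<lambda>k. w k + t * a k) e) = poly q t"
    using quadratic_along_squared_lines[OF g(1) \<open>d \<ge> 1\<close> g(2), where y = "\<lambda>e. (x e)\<^sup>2 - sqd n w e"] by blast
  have fq: "f (\<lambda>e. x e + t * u e) = poly q t" for t
    unfolding f q[symmetric] by (rule polyfun_cong[OF g(1)]) (rule sq)
  have "poly q t = coeff q 0 + coeff q 1 * t + coeff q 2 * t\<^sup>2" for t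
  proof -
    have "poly q t = (\<Sum>i\<le>2. coeff q i * t ^ i)"
      unfolding poly_altdef using \<open>degree q \<le> 2\<close>
      by (intro sum.mono_neutral_left) (auto simp: coeff_eq_0)
    then show ?thesis by (simp add: numeral_2_eq_2 atMost_Suc)
  qed
  then show ?thesis
    unfolding third_difference_def using fq[of 0] fq[of 1] fq[of 2] fq[of 3] by simp
qed

section \<open>Gram minors\<close>

text \<open>Polarization: the inner product of the vectors from vertex \<open>i\<close> to
  \<open>p\<close> and to \<open>q\<close> when \<open>m\<close> holds squared lengths. For
  \<open>p = q\<close> this relies on \<open>m {p}\<close> being zero.\<close>

definition gram :: "(nat set \<Rightarrow> complex) \<Rightarrow> nat \<Rightarrow> nat \<Rightarrow> nat \<Rightarrow> complex" where
  "gram m i p q = (m {i, p} + m {i, q} - m {p, q}) / 2"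

definition gram_det :: "nat \<Rightarrow> nat list \<Rightarrow> nat list \<Rightarrow> (nat set \<Rightarrow> complex) \<Rightarrow> complex" where
  "gram_det i R C m = det (mat (length R) (length R) (\<lambda>(a, b). gram m i (R ! a) (C ! b)))"

lemma gram_meas:
  assumes "i < n" "p < n" "q < n"
  shows "gram (meas d n P) i p q = (\<Sum>k<d. (P p k - P i k) * (P q k - P i k))"
proof -
  have "(\<Sum>k<d. (P p k - P i k) * (P q k - P i k)) =
        (\<Sum>k<d. ((P i k - P p k)\<^sup>2 + (P i k - P q k)\<^sup>2 - (P p k - P q k)\<^sup>2) / 2)"
    by (intro sum.cong) (auto simp: power2_eq_square algebra_simps)
  then show ?thesis
    using assms by (simp add: gram_def meas_pair sum.distrib sum_subtractf flip: sum_divide_distrib)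
qed

lemma gram_det_eq_0:
  assumes "m \<in> Mset d n" "i < n" "set R \<subseteq> {..<n}" "set C \<subseteq> {..<n}"
    and R: "length R = Suc d" and C: "length C = Suc d"
  shows "gram_det i R C m = 0"
proof -
  obtain P where m: "m = meas d n P" using assms(1) by (auto simp: Mset_def)
  \<comment> \<open>The Gram matrix factors through dimension \<open>d\<close>; a zero column pads
    \<open>A\<close> to a square matrix, so that multiplicativity of \<open>det\<close>
    applies.\<close>
  define A where "A = mat (Suc d) (Suc d) (\<lambda>(a, k). if k < d then P (R ! a) k - P i k else 0)"
  define B where "B = mat (Suc d) (Suc d) (\<lambda>(k, b). P (C ! b) k - P i k)"
  have [simp]: "A \<in> carrier_mat (Suc d) (Suc d)" "B \<in> carrier_mat (Suc d) (Suc d)"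
    by (auto simp: A_def B_def)
  have "R ! a < n" "C ! a < n" if "a < Suc d" for a
    using subsetD[OF assms(3) nth_mem[of a R]] subsetD[OF assms(4) nth_mem[of a C]] that R C by simp_all
  then have "mat (length R) (length R) (\<lambda>(a, b). gram m i (R ! a) (C ! b)) = A * B"
    using assms(2) by (intro eq_matI) (auto simp: R m gram_meas A_def B_def scalar_prod_def lessThan_atLeast0 if_distrib
        cong: if_cong)
  moreover have "det A = 0"
    by (subst laplace_expansion_column[of A "Suc d" d]) (auto simp: A_def)
  ultimately show ?thesis using det_mult[of A "Suc d" B] by (simp add: gram_det_def)
qed

text \<open>The edge \<open>{p, q}\<close> enters the matrix only in the last corner:
  \<open>p\<close> indexes no other row, \<open>q\<close> indexes no row and no other column, and
  \<open>i\<close> is off the edge. The factor 1/2 comes from polarization.\<close>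

lemma gram_det_snoc_affine:
  assumes len: "length R = length C" and i: "i \<notin> {p, q}" and "p \<noteq> q"
    and R: "p \<notin> set R" "q \<notin> set R" and C: "q \<notin> set C"
  shows "gram_det i (R @ [p]) (C @ [q]) (m({p, q} := m {p, q} + x))
       = gram_det i (R @ [p]) (C @ [q]) m - x / 2 * gram_det i R C m"
proof -
  let ?m = "m({p, q} := m {p, q} + x)"
  define k where "k = length R"
  define M where "M m = mat (Suc k) (Suc k) (\<lambda>(a, b). gram m i ((R @ [p]) ! a) ((C @ [q]) ! b))" for m
  have car: "M m \<in> carrier_mat (Suc k) (Suc k)" for m by (simp add: M_def)
  have upd: "?m {a, b} = m {a, b} + (if a = p \<and> b = q then x else 0)" if "a \<noteq> q" for a b
    using that \<open>p \<noteq> q\<close> by (auto simp: doubleton_eq_iff)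
  have gram: "gram ?m i a b = gram m i a b - (if a = p \<and> b = q then x / 2 else 0)" if "a \<noteq> q" for a b
    using upd[of i a] upd[of i b] upd[OF that] i by (simp add: gram_def field_simps)
  have Rk: "R ! a \<noteq> p" "R ! a \<noteq> q" if "a < k" for a
    using that R nth_mem[of a R] by (auto simp: k_def)
  have Ck: "C ! b \<noteq> q" if "b < k" for b
    using that C nth_mem[of b C] len by (auto simp: k_def)
  have del: "mat_delete (M ?m) k j = mat_delete (M m) k j" for j
    using Rk by (intro eq_matI) (auto simp: mat_delete_def M_def gram nth_append k_def[symmetric])
  have row: "M ?m $$ (k, j) = M m $$ (k, j) - (if j = k then x / 2 else 0)" if "j < Suc k" for j
    using that \<open>p \<noteq> q\<close> Ck[of j] len
    by (auto simp: M_def gram nth_append k_def[symmetric])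
  have "mat_delete (M m) k k = mat k k (\<lambda>(a, b). gram m i (R ! a) (C ! b))"
    using len by (intro eq_matI) (auto simp: mat_delete_def M_def nth_append k_def[symmetric])
  then have cof: "cofactor (M m) k k = gram_det i R C m"
    by (simp add: cofactor_def gram_det_def k_def)
  have "det (M ?m) = (\<Sum>j<Suc k. M ?m $$ (k, j) * cofactor (M m) k j)"
    using laplace_expansion_row[OF car, of k ?m] by (simp add: cofactor_def del)
  also have "\<dots> = (\<Sum>j<Suc k. M m $$ (k, j) * cofactor (M m) k j - (if j = k then x / 2 * cofactor (M m) k k else 0))"
    by (rule sum.cong) (auto simp: row left_diff_distrib)
  also have "\<dots> = det (M m) - x / 2 * gram_det i R C m"
    using laplace_expansion_row[OF car, of k m] by (simp add: sum_subtractf cof)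
  finally show ?thesis by (simp add: gram_det_def M_def k_def)
qed

abbreviation sq_gram_det :: "nat \<Rightarrow> nat list \<Rightarrow> nat list \<Rightarrow> (nat set \<Rightarrow> complex) \<Rightarrow> complex" where
  "sq_gram_det i R C v \<equiv> gram_det i R C (\<lambda>e. (v e)\<^sup>2)"

text \<open>A shift by \<open>s\<close> changes the squared coordinate by
  \<open>2 * s * v {p, q} + s\<^sup>2\<close>; the steps 1 and -1 together cancel the linear term
  and leave the smaller minor.\<close>

lemma sq_gram_det_second_difference:
  assumes "length R = length C" "i \<notin> {p, q}" "p \<noteq> q" "p \<notin> set R" "q \<notin> set R" "q \<notin> set C"
  shows "sq_gram_det i R C v = 2 * sq_gram_det i (R @ [p]) (C @ [q]) v
     - sq_gram_det i (R @ [p]) (C @ [q]) (v({p, q} := v {p, q} + 1))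
     - sq_gram_det i (R @ [p]) (C @ [q]) (v({p, q} := v {p, q} + (-1)))"
proof -
  have *: "(\<lambda>e. ((v({p, q} := v {p, q} + s)) e)\<^sup>2)
      = (\<lambda>e. (v e)\<^sup>2)({p, q} := (v {p, q})\<^sup>2 + (2 * s * v {p, q} + s\<^sup>2))" for s
    by (auto simp: fun_eq_iff power2_sum)
  have shift: "sq_gram_det i (R @ [p]) (C @ [q]) (v({p, q} := v {p, q} + s))
      = sq_gram_det i (R @ [p]) (C @ [q]) v - (2 * s * v {p, q} + s\<^sup>2) / 2 * sq_gram_det i R C v" for s
    unfolding * by (rule gram_det_snoc_affine[OF assms])
  show ?thesis unfolding shift by (simp add: field_simps)
qed

section \<open>Descent from minors of size \<open>d + 1\<close> to smaller ones\<close>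

lemma third_difference_along_line:
  assumes "\<And>t. f (\<lambda>e. x e + t * w e) = \<phi> t"
  shows "third_difference f x w = \<phi> 3 - 3 * \<phi> 2 + 3 * \<phi> 1 - \<phi> 0"
  using assms[of 3] assms[of 2] assms[of 1] assms[of 0] by (simp add: third_difference_def)

text \<open>The smaller minor is a linear combination of translates of the larger one, and the third
  difference is linear and commutes with translations.\<close>

lemma third_difference_sq_gram_det_butlast:
  assumes rc: "length R = length C" "i \<notin> {p, q}" "p \<noteq> q" "p \<notin> set R" "q \<notin> set R" "q \<notin> set C"
    and "p < n" "q < n"
    and 0: "\<And>x. x \<in> cvec n \<Longrightarrow> third_difference (sq_gram_det i (R @ [p]) (C @ [q])) x w = 0"
    and x: "x \<in> cvec n"
  shows "third_difference (sq_gram_det i R C) x w = 0"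
proof -
  let ?F = "sq_gram_det i (R @ [p]) (C @ [q])"
  let ?x = "\<lambda>s. x({p, q} := x {p, q} + s)"
  have upd: "(\<lambda>e. x e + t * w e)({p, q} := (\<lambda>e. x e + t * w e) {p, q} + s) = (\<lambda>e. ?x s e + t * w e)" for s t
    by auto
  have G: "sq_gram_det i R C (\<lambda>e. x e + t * w e)
      = 2 * ?F (\<lambda>e. x e + t * w e) - ?F (\<lambda>e. ?x 1 e + t * w e) - ?F (\<lambda>e. ?x (-1) e + t * w e)" for t
    by (simp only: sq_gram_det_second_difference[OF rc] upd)
  note td = third_difference_along_line[OF refl]
  have "third_difference (sq_gram_det i R C) x w
      = 2 * third_difference ?F x w - third_difference ?F (?x 1) w - third_difference ?F (?x (-1)) w"
    unfolding td G by (simp only: ring_distribs) simp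
  moreover have "?x s \<in> cvec n" for s using x \<open>p < n\<close> \<open>q < n\<close> \<open>p \<noteq> q\<close> by (auto simp: cvec_def)
  ultimately show ?thesis by (simp only: 0 x) simp
qed

text \<open>The fresh vertices \<open>as\<close> form a path; each second difference in the length of the last path edge
  peels off one row and one column. A path costs only one vertex more than the number of rows,
  which is what \<open>n \<ge> d + 3\<close> allows.\<close>

lemma third_difference_sq_gram_det_path:
  assumes "length R = length C" "as \<noteq> []" "distinct as" "i \<notin> set as" "set as \<inter> set R = {}"
    "set as \<inter> set C = {}" "set as \<subseteq> {..<n}"
    and "\<And>x. x \<in> cvec n \<Longrightarrow> third_difference (sq_gram_det i (R @ butlast as) (C @ tl as)) x w = 0"
    and "x \<in> cvec n"
  shows "third_difference (sq_gram_det i R C) x w = 0"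
  using assms(2-)
proof (induction as arbitrary: x rule: rev_induct)
  case (snoc q as)
  show ?case
  proof (cases as rule: rev_cases)
    case Nil
    then show ?thesis using snoc.prems(7)[OF snoc.prems(8)] by simp
  next
    case (snoc bs p)
    note as = this
    have "as \<noteq> []" using as by simp
    then have tl: "tl (as @ [q]) = tl as @ [q]" by (rule tl_append2)
    have bl: "butlast (as @ [q]) = butlast as @ [p]" unfolding butlast_snoc using as by simp
    have ta: "set (tl as) \<subseteq> set as" by (cases as) auto
    have "third_difference (sq_gram_det i (R @ butlast as) (C @ tl as)) x w = 0" if "x \<in> cvec n" for x
    proof (rule third_difference_sq_gram_det_butlast[OF _ _ _ _ _ _ _ _ _ that])
      show "length (R @ butlast as) = length (C @ tl as)" using assms(1) as by simp
      show "third_difference (sq_gram_det i ((R @ butlast as) @ [p]) ((C @ tl as) @ [q])) x w = 0"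
        if "x \<in> cvec n" for x
        using snoc.prems(7)[OF that] by (simp only: tl bl append_assoc)
    qed (use snoc.prems as ta in auto)
    then show ?thesis using snoc.prems as by (intro snoc.IH) auto
  qed
qed simp

lemma third_difference_sq_gram_det_smaller:
  assumes full: "\<And>i R C x. \<lbrakk>i < n; set R \<subseteq> {..<n}; set C \<subseteq> {..<n}; length R = Suc d; length C = Suc d; x \<in> cvec n\<rbrakk>
      \<Longrightarrow> third_difference (sq_gram_det i R C) x w = 0"
    and "i < n" "set R \<subseteq> {..<n}" "set C \<subseteq> {..<n}" "length R = length C" "length R \<le> Suc d"
    and card: "card (insert i (set R \<union> set C)) + (d + 2) \<le> n + length R"
    and "x \<in> cvec n"
  shows "third_difference (sq_gram_det i R C) x w = 0"
proof -
  let ?K = "insert i (set R \<union> set C)"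
  have K: "?K \<subseteq> {..<n}" using assms(2-4) by auto
  then have "card ({..<n} - ?K) = n - card ?K" by (simp add: card_Diff_subset)
  with card have "d + 2 - length R \<le> card ({..<n} - ?K)" by linarith
  \<comment> \<open>A path on \<open>d + 2 - length R\<close> vertices supplies
    \<open>d + 1 - length R\<close> new rows and columns, which gives the full size
    \<open>d + 1\<close>.\<close>
  then obtain T where T: "T \<subseteq> {..<n} - ?K" "card T = d + 2 - length R" "finite T"
    by (rule obtain_subset_with_card_n)
  then obtain as where as: "set as = T" "distinct as" using finite_distinct_list by blast
  then have len: "length as = d + 2 - length R" using T distinct_card by fastforce
  show ?thesis
  proof (rule third_difference_sq_gram_det_path[of _ _ as])
    show "as \<noteq> []" using len assms(6) by auto
    fix x assume "x \<in> cvec n"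
    moreover have "set (butlast as) \<subseteq> {..<n}" "set (tl as) \<subseteq> {..<n}"
      using as T in_set_butlastD[of _ as] list.set_sel(2)[of as] by (auto, (cases as; auto)+)
    ultimately show "third_difference (sq_gram_det i (R @ butlast as) (C @ tl as)) x w = 0"
      using assms(2-6) len by (intro full) auto
  qed (use assms as T in auto)
qed

section \<open>Linear automorphisms and pulled-back minors\<close>

lemma mat_app_linear:
  "mat_app n A (\<lambda>e. x e + t * u e) = (\<lambda>e. mat_app n A x e + t * mat_app n A u e)"
  by (auto simp: mat_app_def fun_eq_iff sum.distrib sum_distrib_left algebra_simps)

lemma mat_app_in_cvec: "mat_app n A v \<in> cvec n"
  by (simp add: mat_app_def cvec_def)

lemma mat_app_inverse:
  assumes "\<And>e g. e \<in> edges n \<Longrightarrow> g \<in> edges n \<Longrightarrow> mat_mult n A B e g = (if e = g then 1 else 0)"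
    and v: "v \<in> cvec n"
  shows "mat_app n A (mat_app n B v) = v"
proof
  fix e
  show "mat_app n A (mat_app n B v) e = v e"
  proof (cases "e \<in> edges n")
    case True
    have "mat_app n A (mat_app n B v) e = (\<Sum>f\<in>edges n. \<Sum>g\<in>edges n. A e f * B f g * v g)"
      using True by (simp add: mat_app_def sum_distrib_left mult.assoc)
    also have "\<dots> = (\<Sum>g\<in>edges n. mat_mult n A B e g * v g)"
      by (subst sum.swap) (simp add: mat_mult_def sum_distrib_right)
    also have "\<dots> = (\<Sum>g\<in>edges n. if e = g then v g else 0)"
      using True by (intro sum.cong) (auto simp: assms(1))
    finally show ?thesis using True by simp
  qed (use v in \<open>simp add: mat_app_def cvec_def\<close>)
qed

lemma lin_aut_inverse:
  assumes "lin_aut d n A"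
  obtains B where "lin_aut d n B"
    "\<And>v. v \<in> cvec n \<Longrightarrow> mat_app n A (mat_app n B v) = v"
    "\<And>v. v \<in> cvec n \<Longrightarrow> mat_app n B (mat_app n A v) = v"
proof -
  obtain B where B: "\<And>e g. e \<in> edges n \<Longrightarrow> g \<in> edges n \<Longrightarrow> mat_mult n A B e g = (if e = g then 1 else 0)"
    "\<And>e g. e \<in> edges n \<Longrightarrow> g \<in> edges n \<Longrightarrow> mat_mult n B A e g = (if e = g then 1 else 0)"
    using assms unfolding lin_aut_def nonsingular_def by blast
  note inv = mat_app_inverse[OF B(1)] mat_app_inverse[OF B(2)]
  have L: "mat_app n A ` Lset d n = Lset d n" using assms by (simp add: lin_aut_def)
  have "mat_app n B ` Lset d n = mat_app n B ` mat_app n A ` Lset d n" by (simp only: L)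
  also have "\<dots> = (\<lambda>v. v) ` Lset d n"
    unfolding image_image by (intro image_cong) (auto simp: Lset_def inv)
  finally have "lin_aut d n B"
    unfolding lin_aut_def nonsingular_def using B by (intro conjI exI[of _ A] ballI) auto
  then show ?thesis using inv by (intro that[of B])
qed

lemma polyfun_gram_det:
  assumes "length C = length R"
  shows "polyfun (edges n) (2 * length R) (\<lambda>v. sq_gram_det i R C (mat_app n A v))"
proof -
  have "polyfun (edges n) 1 (\<lambda>v. mat_app n A v e)" for e
  proof (cases "e \<in> edges n")
    case True
    then show ?thesis
      unfolding mat_app_def by (auto intro!: polyfun_sum polyfun_cmult polyfun_coord simp del: One_nat_def)
  qed (simp add: mat_app_def polyfun_const)
  from polyfun_power2[OF this]
  have "polyfun (edges n) 2 (\<lambda>v. (1/2) * (((mat_app n A v {i, p})\<^sup>2 + (mat_app n A v {i, q})\<^sup>2) - (mat_app n A v {p, q})\<^sup>2))" for p q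
    by (intro polyfun_cmult polyfun_sub polyfun_add)
  then have gram: "polyfun (edges n) 2 (\<lambda>v. gram (\<lambda>e. (mat_app n A v e)\<^sup>2) i p q)" for p q
    by (simp add: gram_def)
  have "polyfun (edges n) (2 * card {0..<length R})
     (\<lambda>v. \<Prod>a = 0..<length R. gram (\<lambda>e. (mat_app n A v e)\<^sup>2) i (R ! a) (C ! \<pi> a))" for \<pi>
    by (intro polyfun_prod gram)
  then have "polyfun (edges n) (2 * length R) (\<lambda>v. \<Sum>\<pi> | \<pi> permutes {0..<length R}. signof \<pi> *
     (\<Prod>a = 0..<length R. gram (\<lambda>e. (mat_app n A v e)\<^sup>2) i (R ! a) (C ! \<pi> a)))"
    by (intro polyfun_sum polyfun_cmult) simp
  also have "(\<lambda>v. \<Sum>\<pi> | \<pi> permutes {0..<length R}. signof \<pi> *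
     (\<Prod>a = 0..<length R. gram (\<lambda>e. (mat_app n A v e)\<^sup>2) i (R ! a) (C ! \<pi> a)))
     = (\<lambda>v. sq_gram_det i R C (mat_app n A v))"
    unfolding gram_det_def
    by (subst det_def') (auto intro!: ext sum.cong prod.cong dest: permutes_in_image[of _ _ "_::nat"])
  finally show ?thesis .
qed

text \<open>The minor composed with \<open>A\<close> has degree at most \<open>2 * d + 2\<close> and
  vanishes on L, which \<open>A\<close> preserves. Its third difference at
  \<open>mat_app n B x\<close> is that of the minor at \<open>x\<close>.\<close>

lemma third_difference_image_star:
  assumes A: "lin_aut d n A" and "d \<ge> 1" and u: "u \<in> star n j" "j < n"
    and "i < n" "set R \<subseteq> {..<n}" "set C \<subseteq> {..<n}" and R: "length R = Suc d" and C: "length C = Suc d"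
    and x: "x \<in> cvec n"
  shows "third_difference (sq_gram_det i R C) x (mat_app n A u) = 0"
proof -
  let ?f = "\<lambda>v. sq_gram_det i R C (mat_app n A v)"
  obtain B where B: "\<And>v. v \<in> cvec n \<Longrightarrow> mat_app n A (mat_app n B v) = v"
    using lin_aut_inverse[OF A] by metis
  have "third_difference ?f (mat_app n B x) u = 0"
  proof (rule third_difference_star[OF _ \<open>d \<ge> 1\<close> _ u])
    show "polyfun (edges n) (2 * d + 2) ?f" using polyfun_gram_det[of C R n i A] R C by simp
    fix v assume "v \<in> Lset d n"
    then have "mat_app n A v \<in> Lset d n" using A by (auto simp: lin_aut_def)
    then have "(\<lambda>e. (mat_app n A v e)\<^sup>2) \<in> Mset d n" by (simp add: Lset_def sqmap_def)
    then show "?f v = 0" using assms by (intro gram_det_eq_0)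
  qed
  moreover have "third_difference ?f (mat_app n B x) u
      = third_difference (sq_gram_det i R C) (mat_app n A (mat_app n B x)) (mat_app n A u)"
    unfolding third_difference_def
    using mat_app_linear[of n A "mat_app n B x" 1 u] mat_app_linear[of n A "mat_app n B x" 2 u]
      mat_app_linear[of n A "mat_app n B x" 3 u] by simp
  ultimately show ?thesis using B[OF x] by simp
qed

lemma gram_det_2:
  "gram_det i [a, b] [c, d] m = gram m i a c * gram m i b d - gram m i a d * gram m i b c"
proof -
  let ?M = "mat (Suc 1) (Suc 1) (\<lambda>(k, l). gram m i ([a, b] ! k) ([c, d] ! l))"
  have "det ?M = (\<Sum>j<Suc 1. ?M $$ (0, j) * cofactor ?M 0 j)"
    by (rule laplace_expansion_row) auto
  then show ?thesis
    by (simp add: gram_det_def cofactor_def det_single mat_delete_def numeral_2_eq_2)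
qed

lemma gram_det_3:
  "gram_det i [a, b, c] [a', b', c'] m =
     gram m i a a' * gram_det i [b, c] [b', c'] m - gram m i a b' * gram_det i [b, c] [a', c'] m
     + gram m i a c' * gram_det i [b, c] [a', b'] m"
proof -
  let ?M = "mat 3 3 (\<lambda>(k, l). gram m i ([a, b, c] ! k) ([a', b', c'] ! l))"
  have "det ?M = (\<Sum>j<3. ?M $$ (0, j) * cofactor ?M 0 j)"
    by (rule laplace_expansion_row) auto
  moreover have "mat_delete ?M 0 0 = mat 2 2 (\<lambda>(k, l). gram m i ([b, c] ! k) ([b', c'] ! l))"
    "mat_delete ?M 0 1 = mat 2 2 (\<lambda>(k, l). gram m i ([b, c] ! k) ([a', c'] ! l))"
    "mat_delete ?M 0 2 = mat 2 2 (\<lambda>(k, l). gram m i ([b, c] ! k) ([a', b'] ! l))"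
    by (intro eq_matI; auto simp: mat_delete_def less_2_cases_iff)+
  ultimately show ?thesis
    by (simp add: gram_det_def cofactor_def numeral_3_eq_3 numeral_2_eq_2)
qed

section \<open>Directions along which all Gram minors are quadratic\<close>

lemma cvec_singleton: "v \<in> cvec n \<Longrightarrow> v {i} = 0"
  by (simp add: cvec_def)

lemma delta_in_cvec: "e \<in> edges n \<Longrightarrow> (\<lambda>f. if f = e then s else 0) \<in> cvec n"
  by (auto simp: cvec_def)

lemma heron_critical:
  assumes H: "\<And>x. x \<in> cvec n \<Longrightarrow> third_difference (sq_gram_det i [j, k] [j, k]) x w = 0"
    and w: "w \<in> cvec n" and "i < n" "j < n" "k < n" and ne: "i \<noteq> j" "i \<noteq> k" "j \<noteq> k"
  shows "w {i, j} * ((w {i, j})\<^sup>2 - (w {i, k})\<^sup>2 - (w {j, k})\<^sup>2) = 0"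
proof -
  let ?x = "\<lambda>s f. if f = {i, j} then s else 0 :: complex"
  have kj: "{k, j} = {j, k}" by auto
  define a b c where "a = w {i, j}" and "b = w {i, k}" and "c = w {j, k}"
  have val: "sq_gram_det i [j, k] [j, k] (\<lambda>e. ?x s e + t * w e)
      = (s + t * a)\<^sup>2 * (t * b)\<^sup>2 - (((s + t * a)\<^sup>2 + (t * b)\<^sup>2 - (t * c)\<^sup>2) / 2)\<^sup>2" for s t
    using ne by (simp add: gram_det_2 gram_def kj cvec_singleton[OF w] doubleton_eq_iff a_def b_def c_def)
       (simp add: power2_eq_square)
  have T: "third_difference (sq_gram_det i [j, k] [j, k]) (?x s) w = 0" for s
    using assms by (intro H delta_in_cvec) auto
  \<comment> \<open>In \<open>t\<close>, the quartic coefficient does not depend on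
    \<open>s\<close>, so the difference between \<open>s = 1\<close> and \<open>s = 0\<close>
    isolates the cubic coefficient, which the third difference multiplies by 3! = 6.\<close>
  have "- 6 * (a * (a\<^sup>2 - b\<^sup>2 - c\<^sup>2)) = third_difference (sq_gram_det i [j, k] [j, k]) (?x 1) w
      - third_difference (sq_gram_det i [j, k] [j, k]) (?x 0) w"
    unfolding third_difference_along_line[of "sq_gram_det i [j, k] [j, k]", OF val]
    by (simp add: field_simps power2_eq_square power4_eq_xxxx)
  then show ?thesis unfolding T by (simp add: a_def b_def c_def)
qed

lemma heron_critical_solutions:
  fixes a b c :: complex
  assumes "a * (a\<^sup>2 - b\<^sup>2 - c\<^sup>2) = 0" "b * (b\<^sup>2 - a\<^sup>2 - c\<^sup>2) = 0" "c * (c\<^sup>2 - a\<^sup>2 - b\<^sup>2) = 0"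
  shows "a = 0 \<and> b\<^sup>2 = c\<^sup>2 \<or> b = 0 \<and> a\<^sup>2 = c\<^sup>2 \<or> c = 0 \<and> a\<^sup>2 = b\<^sup>2"
proof (cases "a = 0 \<or> b = 0 \<or> c = 0")
  case True
  then show ?thesis using assms by auto
next
  case False
  then have "a\<^sup>2 = b\<^sup>2 + c\<^sup>2" "b\<^sup>2 = a\<^sup>2 + c\<^sup>2" using assms by (simp_all add: diff_diff_eq)
  then have "2 * c\<^sup>2 = 0" by simp
  then show ?thesis using False by simp
qed

text \<open>The triangle conditions leave exactly the multiples of signed cut vectors. The next two lemmas
  exclude cuts with at least two vertices on both sides. For \<open>d = 1\<close> only minors of size two are available,
  for \<open>d \<ge> 2\<close> a Cayley-Menger determinant on four vertices is used.\<close>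

lemma balanced_cut_excluded_1:
  assumes H: "\<And>x. x \<in> cvec n \<Longrightarrow> third_difference (sq_gram_det p [q, r] [r, s]) x w = 0"
    and w: "w \<in> cvec n" and "p < n" "r < n" and ne: "distinct [p, q, r, s]"
    and c: "(w {p, r})\<^sup>2 = c" "(w {p, s})\<^sup>2 = c" "(w {q, r})\<^sup>2 = c" "(w {q, s})\<^sup>2 = c"
    and 0: "w {p, q} = 0" "w {r, s} = 0"
  shows "c = 0"
proof -
  let ?x = "\<lambda>f. if f = {p, r} then 1 else 0 :: complex"
  define a where "a = w {p, r}"
  have sq: "(t * w {p, s})\<^sup>2 = t\<^sup>2 * c" "(t * w {q, r})\<^sup>2 = t\<^sup>2 * c" "(t * w {q, s})\<^sup>2 = t\<^sup>2 * c"
    "(1 + t * w {p, r})\<^sup>2 = 1 + 2 * t * a + t\<^sup>2 * c" for t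
    by (simp_all add: power_mult_distrib power2_sum c a_def)
  have val: "sq_gram_det p [q, r] [r, s] (\<lambda>e. ?x e + t * w e)
      = (1 + 2 * t * a) * (1 + 2 * t * a + 2 * c * t\<^sup>2) / 4" for t
    using ne by (simp add: gram_det_2 gram_def cvec_singleton[OF w] doubleton_eq_iff 0 sq)
  have "third_difference (sq_gram_det p [q, r] [r, s]) ?x w = 6 * c * a"
    unfolding third_difference_along_line[of "sq_gram_det p [q, r] [r, s]", OF val]
    by (simp add: field_simps power2_eq_square)
  moreover have "third_difference (sq_gram_det p [q, r] [r, s]) ?x w = 0"
    using assms by (intro H delta_in_cvec) auto
  ultimately show ?thesis using c(1) by (auto simp: a_def)
qed

lemma balanced_cut_excluded_2:
  assumes H: "\<And>x. x \<in> cvec n \<Longrightarrow> third_difference (sq_gram_det p [q, r, s] [q, r, s]) x w = 0"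
    and w: "w \<in> cvec n" and "p < n" "r < n" and ne: "distinct [p, q, r, s]"
    and c: "(w {p, r})\<^sup>2 = c" "(w {p, s})\<^sup>2 = c" "(w {q, r})\<^sup>2 = c" "(w {q, s})\<^sup>2 = c"
    and 0: "w {p, q} = 0" "w {r, s} = 0"
  shows "c = 0"
proof -
  let ?x = "\<lambda>h f. if f = {p, r} then h else 0 :: complex"
  define a where "a = w {p, r}"
  have comm: "{r, q} = {q, r}" "{s, q} = {q, s}" "{s, r} = {r, s}" by auto
  have sq: "(t * w {p, s})\<^sup>2 = t\<^sup>2 * c" "(t * w {q, r})\<^sup>2 = t\<^sup>2 * c" "(t * w {q, s})\<^sup>2 = t\<^sup>2 * c"
    "(h + t * w {p, r})\<^sup>2 = h\<^sup>2 + 2 * h * t * a + t\<^sup>2 * c" for t h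
    by (simp_all add: power_mult_distrib power2_sum c a_def)
  have val: "sq_gram_det p [q, r, s] [q, r, s] (\<lambda>e. ?x h e + t * w e)
      = - ((h\<^sup>2 + 2 * h * t * a) / 2)\<^sup>2 * (t\<^sup>2 * c)" for h t
    using ne by (simp add: gram_det_3 gram_det_2 gram_def cvec_singleton[OF w] doubleton_eq_iff 0 comm sq)
      (simp add: field_simps power2_eq_square)
  have a2: "a * a = c" using c(1) by (simp add: a_def power2_eq_square)
  have "third_difference (sq_gram_det p [q, r, s] [q, r, s]) (?x h) w = - 36 * h\<^sup>2 * (a * a) * c - 6 * h ^ 3 * c * a" for h
    unfolding third_difference_along_line[of "sq_gram_det p [q, r, s] [q, r, s]", OF val]
    by (simp add: field_simps power2_eq_square power3_eq_cube)
  moreover have "third_difference (sq_gram_det p [q, r, s] [q, r, s]) (?x h) w = 0" for h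
    using assms by (intro H delta_in_cvec) auto
  ultimately have eq: "- 36 * h\<^sup>2 * (a * a) * c - 6 * h ^ 3 * c * a = 0" for h by metis
  \<comment> \<open>Adding the values at \<open>h = 1\<close> and \<open>h = -1\<close> cancels the
    part odd in \<open>h\<close> and leaves \<open>- 72 * (a * a) * c\<close>.\<close>
  have "(- 36 * 1\<^sup>2 * (a * a) * c - 6 * 1 ^ 3 * c * a)
      + (- 36 * (-1)\<^sup>2 * (a * a) * c - 6 * (-1) ^ 3 * c * a) = 0"
    by (simp only: eq) simp
  then have "c * c = 0" by (simp add: a2)
  then show ?thesis by simp
qed

text \<open>A vertex with only nonzero edges is the centre of a star, by the triangle conditions. If
  neither end of a nonzero edge \<open>{i, j}\<close> is such a vertex, there are zero edges
  \<open>{i, k}\<close> and \<open>{j, l}\<close>, and the triangles turn these pairs into the two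
  sides of a balanced cut.\<close>

lemma star_if_no_balanced_cut:
  assumes w: "w \<in> cvec n" "w \<noteq> (\<lambda>_. 0)"
    and tri: "\<And>i j k. \<lbrakk>i < n; j < n; k < n; i \<noteq> j; i \<noteq> k; j \<noteq> k\<rbrakk>
      \<Longrightarrow> w {i, j} * ((w {i, j})\<^sup>2 - (w {i, k})\<^sup>2 - (w {j, k})\<^sup>2) = 0"
    and cut: "\<And>p q r s c. \<lbrakk>p < n; q < n; r < n; s < n; distinct [p, q, r, s];
      (w {p, r})\<^sup>2 = c; (w {p, s})\<^sup>2 = c; (w {q, r})\<^sup>2 = c; (w {q, s})\<^sup>2 = c;
      w {p, q} = 0; w {r, s} = 0\<rbrakk> \<Longrightarrow> c = 0"
  shows "\<exists>j<n. w \<in> star n j"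
proof -
  have T: "w {i, j} = 0 \<and> (w {i, k})\<^sup>2 = (w {j, k})\<^sup>2 \<or> w {i, k} = 0 \<and> (w {i, j})\<^sup>2 = (w {j, k})\<^sup>2
      \<or> w {j, k} = 0 \<and> (w {i, j})\<^sup>2 = (w {i, k})\<^sup>2"
    if "i < n" "j < n" "k < n" "i \<noteq> j" "i \<noteq> k" "j \<noteq> k" for i j k
    using heron_critical_solutions[of "w {i, j}" "w {i, k}" "w {j, k}"]
      tri[of i j k] tri[of i k j] tri[of j k i] that
    by (simp add: insert_commute)
  obtain e where e: "w e \<noteq> 0" using w(2) by auto
  then have "e \<in> edges n" using w(1) by (auto simp: cvec_def)
  then obtain i j where ij: "e = {i, j}" "i < n" "j < n" "i \<noteq> j" by (rule edgesE)
  have star: "w \<in> star n i"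
    if all: "\<And>k. k < n \<Longrightarrow> k \<noteq> i \<Longrightarrow> w {i, k} \<noteq> 0" and i: "i < n" and j: "j < n" "i \<noteq> j" for i j
  proof -
    have ik: "(w {i, k})\<^sup>2 = (w {i, j})\<^sup>2 \<and> (k \<noteq> j \<longrightarrow> w {j, k} = 0)" if "k < n" "k \<noteq> i" for k
      using T[of i j k] all[of k] all[of j] that i j by (cases "k = j") auto
    have kl: "w {k, l} = 0" if "k < n" "k \<noteq> i" "l < n" "l \<noteq> i" "k \<noteq> l" for k l
      using T[of i k l] all[of k] all[of l] that i by auto
    have "(w f)\<^sup>2 = (if i \<in> f then (w {i, j})\<^sup>2 else 0)" if f: "f \<in> edges n" for f
    proof (cases "i \<in> f")
      case True
      from edges_containE[OF f True] ik show ?thesis by (metis insertI1)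
    next
      case False
      then show ?thesis using f kl by (auto elim!: edgesE)
    qed
    moreover have "w {i, j} \<noteq> 0" using all[of j] j by simp
    ultimately show ?thesis unfolding star_def using w(1) by blast
  qed
  show ?thesis
  proof (cases "(\<forall>k<n. k \<noteq> i \<longrightarrow> w {i, k} \<noteq> 0) \<or> (\<forall>k<n. k \<noteq> j \<longrightarrow> w {j, k} \<noteq> 0)")
    case True
    then show ?thesis using star[of i j] star[of j i] ij by metis
  next
    case False
    then obtain k l where kl: "k < n" "k \<noteq> i" "w {i, k} = 0" "l < n" "l \<noteq> j" "w {j, l} = 0" by blast
    have ne: "k \<noteq> j" "l \<noteq> i" using kl e ij by (auto simp: insert_commute)
    have jk: "(w {j, k})\<^sup>2 = (w {i, j})\<^sup>2" using T[of i j k] kl ij ne e by auto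
    have il: "(w {i, l})\<^sup>2 = (w {i, j})\<^sup>2" using T[of i j l] kl ij ne e by auto
    have "k \<noteq> l" using kl il e ij by auto
    then have lk: "(w {k, l})\<^sup>2 = (w {i, j})\<^sup>2" using T[of i k l] kl ij ne e il by auto
    have "(w {i, j})\<^sup>2 = 0"
      by (rule cut[of i k j l]) (use kl ij ne jk il lk \<open>k \<noteq> l\<close> in \<open>auto simp: insert_commute\<close>)
    then show ?thesis using e ij by simp
  qed
qed

lemma star_nonzero:
  assumes "u \<in> star n j" "j < n" "k < n" "k \<noteq> j"
  shows "u {j, k} \<noteq> 0"
proof -
  obtain c where "c \<noteq> 0" "\<forall>e\<in>edges n. (u e)\<^sup>2 = (if j \<in> e then c\<^sup>2 else 0)"
    using assms(1) by (auto simp: star_def)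
  moreover have "{j, k} \<in> edges n" using assms by simp
  ultimately show ?thesis by fastforce
qed

lemma star_zero: "u \<in> star n j \<Longrightarrow> j \<notin> e \<Longrightarrow> u e = 0"
  by (cases "e \<in> edges n") (auto simp: star_def cvec_def)

lemma mat_app_zero: "mat_app n A (\<lambda>_. 0) = (\<lambda>_. 0)"
  by (simp add: mat_app_def fun_eq_iff)

lemma lin_aut_maps_star_to_star:
  assumes A: "lin_aut d n A" and "d \<ge> 1" "n \<ge> d + 3" and u: "u \<in> star n j" "j < n"
  shows "\<exists>k<n. mat_app n A u \<in> star n k"
proof (rule star_if_no_balanced_cut)
  let ?w = "mat_app n A u"
  show w: "?w \<in> cvec n" by (rule mat_app_in_cvec)
  show "?w \<noteq> (\<lambda>_. 0)"
  proof
    assume "?w = (\<lambda>_. 0)"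
    moreover obtain B where "\<And>v. v \<in> cvec n \<Longrightarrow> mat_app n B (mat_app n A v) = v"
      using lin_aut_inverse[OF A] by metis
    moreover have "u \<in> cvec n" using u by (simp add: star_def)
    ultimately have "u = (\<lambda>_. 0)" by (metis mat_app_zero)
    moreover obtain k where "k < n" "k \<noteq> j"
      using \<open>n \<ge> d + 3\<close> that[of 0] that[of 1] by (cases "j = 0") auto
    ultimately show False using star_nonzero[OF u] by metis
  qed
  have full: "third_difference (sq_gram_det i R C) x ?w = 0"
    if "i < n" "set R \<subseteq> {..<n}" "set C \<subseteq> {..<n}" "length R = Suc d" "length C = Suc d" "x \<in> cvec n"
    for i R C x
    using third_difference_image_star[OF A \<open>d \<ge> 1\<close> u] that .
  \<comment> \<open>The vertex count requires exactly \<open>n \<ge> d + 3\<close> in both uses: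
    three vertices with size two, and four vertices with size three. Size three needs
    \<open>d \<ge> 2\<close>; for \<open>d = 1\<close>, size two is already full.\<close>
  note smaller = third_difference_sq_gram_det_smaller[where w = "?w" and d = d and n = n, OF full]
  show "?w {i, j} * ((?w {i, j})\<^sup>2 - (?w {i, k})\<^sup>2 - (?w {j, k})\<^sup>2) = 0"
    if "i < n" "j < n" "k < n" "i \<noteq> j" "i \<noteq> k" "j \<noteq> k" for i j k
  proof (rule heron_critical[OF _ w])
    show "third_difference (sq_gram_det i [j, k] [j, k]) x ?w = 0" if "x \<in> cvec n" for x
      by (rule smaller) (use that \<open>d \<ge> 1\<close> \<open>n \<ge> d + 3\<close> \<open>i < n\<close> \<open>j < n\<close> \<open>k < n\<close> in \<open>auto simp: card_insert_if\<close>)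
  qed (use that in auto)
  show "c = 0" if pqrs: "p < n" "q < n" "r < n" "s < n" "distinct [p, q, r, s]"
    and c: "(?w {p, r})\<^sup>2 = c" "(?w {p, s})\<^sup>2 = c" "(?w {q, r})\<^sup>2 = c" "(?w {q, s})\<^sup>2 = c"
    and 0: "?w {p, q} = 0" "?w {r, s} = 0" for p q r s c
  proof (cases "d = 1")
    case True
    show ?thesis
      by (rule balanced_cut_excluded_1[OF _ w _ _ pqrs(5) c 0]) (use True pqrs in \<open>auto intro!: full\<close>)
  next
    case False
    show ?thesis
    proof (rule balanced_cut_excluded_2[OF _ w _ _ pqrs(5) c 0])
      show "third_difference (sq_gram_det p [q, r, s] [q, r, s]) x ?w = 0" if "x \<in> cvec n" for x
        by (rule smaller) (use that False pqrs \<open>d \<ge> 1\<close> \<open>n \<ge> d + 3\<close> in \<open>auto simp: card_insert_if\<close>)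
    qed (use pqrs in auto)
  qed
qed

section \<open>Automorphisms permute the stars\<close>

definition edge_vec :: "nat set \<Rightarrow> nat set \<Rightarrow> complex" where
  "edge_vec f = (\<lambda>e. if e = f then 1 else 0)"

definition star_vec :: "nat \<Rightarrow> nat \<Rightarrow> nat set \<Rightarrow> complex" where
  "star_vec n j = (\<lambda>e. if e \<in> edges n \<and> j \<in> e then 1 else 0)"

lemma lin_aut_inject:
  assumes "lin_aut d n A" "v \<in> cvec n" "w \<in> cvec n" "mat_app n A v = mat_app n A w"
  shows "v = w"
  using lin_aut_inverse[OF assms(1)] assms(2-4) by metis

lemma mat_app_edge_vec: "e \<in> edges n \<Longrightarrow> f \<in> edges n \<Longrightarrow> mat_app n A (edge_vec f) e = A e f"
  by (simp add: mat_app_def edge_vec_def if_distrib cong: if_cong)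

lemma star_vec_in_star: "star_vec n j \<in> star n j"
  by (auto simp: star_def star_vec_def cvec_def intro: exI[of _ 1])

lemma flip_in_star:
  assumes "u \<in> star n j"
  shows "u(f := - u f) \<in> star n j"
proof -
  have "((u(f := - u f)) e)\<^sup>2 = (u e)\<^sup>2" for e by simp
  moreover have "u(f := - u f) \<in> cvec n" using assms by (auto simp: star_def cvec_def)
  ultimately show ?thesis using assms unfolding star_def by (simp del: fun_upd_apply)
qed

lemma mat_app_flip:
  "mat_app n A (u(f := - u f)) e = mat_app n A u e - 2 * u f * mat_app n A (edge_vec f) e"
proof -
  have "u(f := - u f) = (\<lambda>e. u e + (- 2 * u f) * edge_vec f e)"
    by (auto simp: edge_vec_def fun_eq_iff)
  then show ?thesis by (simp only: mat_app_linear) simp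
qed

text \<open>As \<open>n \<ge> 5\<close>, some vertex \<open>x\<close> avoids all four centres. On
  the edge \<open>{a, x}\<close> only \<open>w\<close> is nonzero unless \<open>a\<close> is
  \<open>c\<close> or \<open>c'\<close>; the same holds for \<open>b\<close>.\<close>

lemma star_pair_unique:
  assumes w: "w \<in> star n a" "w' \<in> star n b" "a < n" "b < n" "a \<noteq> b" and "n \<ge> 5"
    and v: "v \<in> star n c" "v' \<in> star n c'"
    and eq: "\<And>e. w e - w' e = s * (v e - v' e)"
  shows "{c, c'} = {a, b}"
proof -
  have *: "a \<in> {c, c'}" if w: "w \<in> star n a" "w' \<in> star n b" "a < n" "b < n" "a \<noteq> b"
    and eq: "\<And>e. w e - w' e = s * (v e - v' e)" for w w' a b s
  proof (rule ccontr)
    assume a: "a \<notin> {c, c'}"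
    have "\<not> {..<n} \<subseteq> {a, b, c, c'}"
      using \<open>n \<ge> 5\<close> card_mono[of "{a, b, c, c'}" "{..<n}"] card_length[of "[a, b, c, c']"] by auto
    then obtain x where x: "x < n" "x \<notin> {a, b, c, c'}" by auto
    have "w {a, x} \<noteq> 0" using star_nonzero[OF w(1,3) x(1)] x by auto
    moreover have "w' {a, x} = 0" using star_zero[OF w(2)] x w(5) by auto
    moreover have "v {a, x} = 0" "v' {a, x} = 0"
      using star_zero[OF v(1)] star_zero[OF v(2)] x a by auto
    ultimately show False using eq[of "{a, x}"] by simp
  qed
  have "w' e - w e = (- s) * (v e - v' e)" for e using eq[of e] by (simp add: algebra_simps)
  from *[OF w eq] *[OF w(2,1,4,3) w(5)[symmetric] this] \<open>a \<noteq> b\<close> show ?thesis by auto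
qed

text \<open>For \<open>n = 4\<close> the Regge symmetries permute the lines spanned by star vectors without permuting the stars,
  so for \<open>d = 1\<close> the set \<open>L\<close> itself has to be used: the sum of two nonproportional star vectors can lie in
  \<open>L\<close> only if their stars differ.\<close>

lemma flip_preserves_star_dim_1:
  assumes A: "lin_aut 1 n A" and "n \<ge> 3" and u: "u \<in> star n j" "j < n" "k < n" "k \<noteq> j"
    and w: "mat_app n A u \<in> star n a" "mat_app n A (u({j, k} := - u {j, k})) \<in> star n b" "a < n" "b < n"
  shows "a = b"
proof (rule ccontr)
  assume "a \<noteq> b"
  let ?u = "u({j, k} := - u {j, k})"
  let ?w = "mat_app n A u" and ?w' = "mat_app n A ?u"
  define v where "v = (\<lambda>e. u e + 1 * ?u e)"
  \<comment> \<open>With \<open>a\<close> and \<open>b\<close> at these points of the line and all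
    other vertices at the origin, the measurements are the squares of \<open>?w + ?w'\<close>, so
    the sum of the two images lies in L.\<close>
  define p where "p = (\<lambda>(i::nat) (k::nat). if i = a then ?w {a, b} else if i = b then - ?w' {a, b} else 0)"
  have sq: "(?w e)\<^sup>2 = (?w {a, b})\<^sup>2" if "e \<in> edges n" "a \<in> e" for e
    using w(1,3,4) that \<open>a \<noteq> b\<close> unfolding star_def by force
  have sq': "(?w' e)\<^sup>2 = (?w' {a, b})\<^sup>2" if "e \<in> edges n" "b \<in> e" for e
    using w(2-4) that \<open>a \<noteq> b\<close> unfolding star_def by force
  note z = star_zero[OF w(1)] star_zero[OF w(2)]
  have Av: "mat_app n A v = (\<lambda>e. ?w e + ?w' e)" using mat_app_linear[of n A u 1 ?u] by (simp only: v_def mult_1)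
  have "(?w e + ?w' e)\<^sup>2 = meas 1 n p e" for e
  proof (cases "e \<in> edges n")
    case True
    then obtain x y where e: "e = {x, y}" "x < n" "y < n" "x \<noteq> y" by (rule edgesE)
    show ?thesis
    proof (cases "a \<in> e")
      case a: True
      obtain y where y: "e = {a, y}" "y < n" "y \<noteq> a" using edges_containE[OF True a] .
      show ?thesis
      proof (cases "y = b")
        case True
        then show ?thesis using y \<open>a < n\<close> \<open>a \<noteq> b\<close> by (simp add: meas_pair p_def)
      next
        case False
        then show ?thesis using y \<open>a < n\<close> \<open>a \<noteq> b\<close> sq[OF True a] z(2)[of e] by (simp add: meas_pair p_def)
      qed
    next
      case a: False
      show ?thesis
      proof (cases "b \<in> e")
        case b: True
        obtain y where y: "e = {b, y}" "y < n" "y \<noteq> b" using edges_containE[OF True b] .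
        then show ?thesis using a \<open>b < n\<close> \<open>a \<noteq> b\<close> sq'[OF True b] z(1)[of e] by (simp add: meas_pair p_def)
      next
        case False
        then show ?thesis using a e z[of e] by (simp add: meas_pair p_def)
      qed
    qed
  qed (simp add: mat_app_def meas_def)
  then have "mat_app n A v \<in> Lset 1 n"
    unfolding Lset_def using mat_app_in_cvec[of n A v] by (auto simp: Av sqmap_def Mset_def)
  moreover obtain B where B: "lin_aut 1 n B" "\<And>v. v \<in> cvec n \<Longrightarrow> mat_app n B (mat_app n A v) = v"
    using lin_aut_inverse[OF A] by metis
  moreover have vc: "v \<in> cvec n" using u by (auto simp: v_def star_def cvec_def)
  ultimately have "v \<in> Lset 1 n" unfolding lin_aut_def by (metis imageI)
  then obtain P where P: "(\<lambda>e. (v e)\<^sup>2) = meas 1 n P" by (auto simp: Lset_def sqmap_def Mset_def)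
  \<comment> \<open>The preimage \<open>v\<close> vanishes on \<open>{j, k}\<close> and
    \<open>{k, l}\<close> but not on \<open>{j, l}\<close>, which three points on a line do not
    allow.\<close>
  have "\<not> {..<n} \<subseteq> {j, k}"
    using \<open>n \<ge> 3\<close> card_mono[of "{j, k}" "{..<n}"] card_length[of "[j, k]"] by auto
  then obtain l where l: "l < n" "l \<noteq> j" "l \<noteq> k" by auto
  have "(P j 0 - P k 0)\<^sup>2 = (v {j, k})\<^sup>2" "(P k 0 - P l 0)\<^sup>2 = (v {k, l})\<^sup>2" "(P j 0 - P l 0)\<^sup>2 = (v {j, l})\<^sup>2"
    using fun_cong[OF P, of "{j, k}"] fun_cong[OF P, of "{k, l}"] fun_cong[OF P, of "{j, l}"] l u
    by (simp_all add: meas_pair)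
  moreover have "v {j, k} = 0" by (simp add: v_def)
  moreover have "v {k, l} = 0" using star_zero[OF u(1), of "{k, l}"] l u by (auto simp: v_def)
  moreover have "v {j, l} = 2 * u {j, l}" using l u by (auto simp: v_def doubleton_eq_iff)
  ultimately show False using star_nonzero[OF u(1,2) l(1,2)] by auto
qed

text \<open>If flipping \<open>{j, k}\<close> moves the star from \<open>a\<close> to
  \<open>b\<close>, every other edge at \<open>j\<close> is \<open>fixed\<close> (its image is
  supported on \<open>{a, b}\<close>) or \<open>swapped\<close> (its flip also moves the star to
  \<open>b\<close>). At most one edge is of each kind, but \<open>n \<ge> 5\<close> leaves three
  edges.\<close>

lemma flip_preserves_star_dim_ge_2:
  assumes A: "lin_aut d n A" and "d \<ge> 1" "n \<ge> d + 3" "n \<ge> 5"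
    and u: "u \<in> star n j" "j < n" "k < n" "k \<noteq> j"
    and w: "mat_app n A u \<in> star n a" "mat_app n A (u({j, k} := - u {j, k})) \<in> star n b" "a < n" "b < n"
  shows "a = b"
proof (rule ccontr)
  assume "a \<noteq> b"
  define flip where "flip l v = v({j, l} := - v {j, l})" for l and v :: "nat set \<Rightarrow> complex"
  \<comment> \<open>\<open>h l\<close> is what flipping \<open>{j, l}\<close> subtracts from the
    image of any vector that agrees with \<open>u\<close> at \<open>{j, l}\<close>.\<close>
  define h where "h l e = 2 * u {j, l} * mat_app n A (edge_vec {j, l}) e" for l e
  have fl: "flip l v \<in> star n j" if "v \<in> star n j" for l v
    using flip_in_star[OF that] by (simp add: flip_def)
  have fl2: "flip l v {j, m} = v {j, m}" if "l \<noteq> m" "m \<noteq> j" for l m v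
    using that by (auto simp: flip_def doubleton_eq_iff)
  have Afl: "mat_app n A (flip l v) e = mat_app n A v e - h l e" if "v {j, l} = u {j, l}" for l v e
    using mat_app_flip[of n A v "{j, l}" e] that by (simp add: flip_def h_def)
  have img: "\<exists>c<n. mat_app n A v \<in> star n c" if "v \<in> star n j" for v
    using lin_aut_maps_star_to_star[OF A _ _ that] assms by auto
  have swap: "{c, c'} = {a, b}"
    if "mat_app n A (flip l u) \<in> star n b" "m \<noteq> l" "m \<noteq> j" "l \<noteq> j" "mat_app n A (flip m u) \<in> star n c"
      "mat_app n A (flip l (flip m u)) \<in> star n c'" for l m c c'
  proof (rule star_pair_unique[OF w(1) that(1) w(3,4) \<open>a \<noteq> b\<close> \<open>n \<ge> 5\<close> that(5,6), of 1])
    show "mat_app n A u e - mat_app n A (flip l u) e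
      = 1 * (mat_app n A (flip m u) e - mat_app n A (flip l (flip m u)) e)" for e
      using Afl[of "flip m u" l e] Afl[of u l e] fl2[of m l u] that by simp
  qed
  have ksw: "mat_app n A (flip k u) \<in> star n b" using w(2) by (simp add: flip_def)
  have hk: "h k e = mat_app n A u e - mat_app n A (flip k u) e" for e using Afl[of u k e] by simp
  have alt: "(\<forall>e. e \<noteq> {a, b} \<longrightarrow> h l e = 0) \<or>
      mat_app n A (flip l u) \<in> star n b \<and> (\<forall>e. a \<notin> e \<longrightarrow> h k e + h l e = 0)"
    if l: "l < n" "l \<noteq> j" "l \<noteq> k" for l
  proof -
    obtain c where c: "c < n" "mat_app n A (flip l u) \<in> star n c" using img fl u by blast
    obtain c' where c': "c' < n" "mat_app n A (flip k (flip l u)) \<in> star n c'" using img fl u by blast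
    have cc: "{c, c'} = {a, b}" using swap[OF ksw l(3,2) u(4) c(2) c'(2)] .
    have hl: "h l e = mat_app n A u e - mat_app n A (flip l u) e" for e using Afl[of u l e] by simp
    have hl2: "h k e = mat_app n A (flip l u) e - mat_app n A (flip k (flip l u)) e" for e
      using Afl[of "flip l u" k e] fl2[of l k u] l u by simp
    show ?thesis
    proof (cases "c = a")
      case True
      then have "c' = b" using cc \<open>a \<noteq> b\<close> by (auto simp: doubleton_eq_iff)
      \<comment> \<open>\<open>h l\<close> is a difference of two vectors at the star of
        \<open>a\<close> and, after flipping \<open>{j, k}\<close>, also of two at the star of
        \<open>b\<close>; only the edge \<open>{a, b}\<close> is in both.\<close>
      have "h l e = 0" if "e \<noteq> {a, b}" for e
      proof (cases "a \<in> e \<and> b \<in> e")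
        case False
        show ?thesis
        proof (cases "a \<in> e")
          case a: True
          then have "b \<notin> e" using False by simp
          have "h l e = mat_app n A (flip k u) e - mat_app n A (flip k (flip l u)) e"
            using Afl[of u k e] Afl[of "flip l u" k e] hl[of e] fl2[of l k u] l u by simp
          then show ?thesis
            using star_zero[OF ksw \<open>b \<notin> e\<close>] star_zero[OF c'(2)[unfolded \<open>c' = b\<close>] \<open>b \<notin> e\<close>] by simp
        next
          case a: False
          then show ?thesis
            using hl[of e] star_zero[OF w(1) a] star_zero[OF c(2)[unfolded \<open>c = a\<close>] a] by simp
        qed
      next
        case ab: True
        have "e \<notin> edges n" using ab that \<open>a \<noteq> b\<close> by (auto elim!: edgesE)
        then show ?thesis by (simp add: h_def mat_app_def)
      qed
      then show ?thesis by blast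
    next
      case False
      then have "c = b" "c' = a" using cc by (auto simp: doubleton_eq_iff)
      have "h k e + h l e = 0" if "a \<notin> e" for e
        using hl[of e] hl2[of e] star_zero[OF w(1) that] star_zero[OF c'(2)[unfolded \<open>c' = a\<close>] that] by simp
      then show ?thesis using c(2) \<open>c = b\<close> by blast
    qed
  qed
  \<comment> \<open>Two images supported on the same edge are proportional; injectivity forces the
    coefficients of this relation to vanish.\<close>
  have inj: "h m {a, b} = 0" if lm: "l < n" "l \<noteq> j" "m < n" "m \<noteq> j" "l \<noteq> m"
    and hl: "\<forall>e. e \<noteq> {a, b} \<longrightarrow> h l e = 0" and hm: "\<forall>e. e \<noteq> {a, b} \<longrightarrow> h m e = 0" for l m
  proof -
    let ?v = "\<lambda>e. h m {a, b} * (2 * u {j, l}) * edge_vec {j, l} e + (- h l {a, b} * (2 * u {j, m})) * edge_vec {j, m} e"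
    have "mat_app n A ?v e = h m {a, b} * h l e - h l {a, b} * h m e" for e
      using mat_app_linear[of n A "\<lambda>e. 0 + h m {a, b} * (2 * u {j, l}) * edge_vec {j, l} e"
          "- h l {a, b} * (2 * u {j, m})" "edge_vec {j, m}"]
        mat_app_linear[of n A "\<lambda>_. 0" "h m {a, b} * (2 * u {j, l})" "edge_vec {j, l}"]
      by (simp add: mat_app_zero h_def)
    then have "mat_app n A ?v e = 0" for e using hl hm by (cases "e = {a, b}") auto
    then have "mat_app n A ?v = (\<lambda>_. 0)" by blast
    then have Av: "mat_app n A ?v = mat_app n A (\<lambda>_. 0)" by (simp only: mat_app_zero)
    have v: "?v \<in> cvec n" using lm u by (auto simp: cvec_def edge_vec_def)
    have "?v = (\<lambda>_. 0)" by (rule lin_aut_inject[OF A v _ Av]) (simp add: cvec_def)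
    from fun_cong[OF this, of "{j, l}"] show ?thesis
      using lm star_nonzero[OF u(1,2) lm(1,2)] by (simp add: edge_vec_def doubleton_eq_iff)
  qed
  have not_two_fixed: "\<not> (\<forall>e. e \<noteq> {a, b} \<longrightarrow> h l e = 0) \<or> \<not> (\<forall>e. e \<noteq> {a, b} \<longrightarrow> h m e = 0)"
    if lm: "l < n" "l \<noteq> j" "m < n" "m \<noteq> j" "l \<noteq> m" for l m
  proof (rule ccontr)
    assume "\<not> ?thesis"
    then have hm: "\<forall>e. e \<noteq> {a, b} \<longrightarrow> h m e = 0" and hl: "\<forall>e. e \<noteq> {a, b} \<longrightarrow> h l e = 0" by auto
    have "h m e = 0" for e using hm inj[OF lm hl hm] by (cases "e = {a, b}") auto
    then have "mat_app n A (flip m u) = mat_app n A u" using Afl[of u m] by (simp add: fun_eq_iff)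
    moreover have "flip m u \<in> cvec n" "u \<in> cvec n" using u fl[of u m] by (auto simp: star_def)
    ultimately have "flip m u = u" using lin_aut_inject[OF A] by blast
    from fun_cong[OF this, of "{j, m}"] show False
      using star_nonzero[OF u(1,2) lm(3,4)] by (simp add: flip_def)
  qed
  have not_two_swapped: False
    if lm: "l < n" "l \<noteq> j" "l \<noteq> k" "m < n" "m \<noteq> j" "m \<noteq> k" "l \<noteq> m"
      and l: "mat_app n A (flip l u) \<in> star n b" "\<forall>e. a \<notin> e \<longrightarrow> h k e + h l e = 0"
      and m: "mat_app n A (flip m u) \<in> star n b" "\<forall>e. a \<notin> e \<longrightarrow> h k e + h m e = 0" for l m
  proof -
    obtain c' where c': "c' < n" "mat_app n A (flip l (flip m u)) \<in> star n c'" using img fl u by blast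
    have "{b, c'} = {a, b}" using swap[OF l(1) _ _ _ m(1) c'(2)] lm by auto
    then have "c' = a" using \<open>a \<noteq> b\<close> by (auto simp: doubleton_eq_iff)
    have Afl2: "mat_app n A (flip l (flip m u)) e = mat_app n A u e - h m e - h l e" for e
      using Afl[of "flip m u" l e] Afl[of u m e] fl2[of m l u] lm by simp
    have ml: "h m e + h l e = 0" if "a \<notin> e" for e
      using Afl2[of e] star_zero[OF w(1) that] star_zero[OF c'(2)[unfolded \<open>c' = a\<close>] that]
      by (simp add: algebra_simps)
    obtain x where x: "x < n" "x \<noteq> a" "x \<noteq> b"
    proof -
      have "\<not> {..<n} \<subseteq> {a, b}"
        using \<open>n \<ge> 5\<close> card_mono[of "{a, b}" "{..<n}"] card_length[of "[a, b]"] by auto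
      then show ?thesis using that by auto
    qed
    have na: "a \<notin> {b, x}" using x \<open>a \<noteq> b\<close> by simp
    \<comment> \<open>Off the star of \<open>a\<close> the pairwise sums of \<open>h k\<close>,
      \<open>h l\<close> and \<open>h m\<close> vanish, hence so does \<open>h k\<close>; but
      flipping \<open>{j, k}\<close> makes the entry at \<open>{b, x}\<close> nonzero.\<close>
    have "2 * h k {b, x} = (h k {b, x} + h l {b, x}) + (h k {b, x} + h m {b, x}) - (h m {b, x} + h l {b, x})"
      by simp
    also have "\<dots> = 0" unfolding l(2)[rule_format, OF na] m(2)[rule_format, OF na] ml[OF na] by simp
    finally have "h k {b, x} = 0" by simp
    then have "mat_app n A u {b, x} = mat_app n A (flip k u) {b, x}" using hk by simp
    then show False using star_nonzero[OF ksw \<open>b < n\<close> x(1,3)] star_zero[OF w(1) na] by simp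
  qed
  have "3 \<le> card ({..<n} - {j, k})" using \<open>n \<ge> 5\<close> u by (simp add: card_Diff_subset)
  then obtain T where T: "T \<subseteq> {..<n} - {j, k}" "card T = 3" by (meson obtain_subset_with_card_n)
  then obtain x y z where "T = {x, y, z}" "x \<noteq> y" "x \<noteq> z" "y \<noteq> z" by (auto simp: card_3_iff)
  with T have xyz: "x < n" "x \<noteq> j" "x \<noteq> k" "y < n" "y \<noteq> j" "y \<noteq> k" "z < n" "z \<noteq> j" "z \<noteq> k"
    "x \<noteq> y" "x \<noteq> z" "y \<noteq> z" by auto
  define fixed where "fixed l \<longleftrightarrow> (\<forall>e. e \<noteq> {a, b} \<longrightarrow> h l e = 0)" for l
  define swapped where "swapped l \<longleftrightarrow>
    mat_app n A (flip l u) \<in> star n b \<and> (\<forall>e. a \<notin> e \<longrightarrow> h k e + h l e = 0)" for l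
  have "fixed l \<or> swapped l" if "l \<in> {x, y, z}" for l
    using alt[of l] that xyz unfolding fixed_def swapped_def by blast
  moreover have "\<not> fixed l \<or> \<not> fixed m" "\<not> swapped l \<or> \<not> swapped m"
    if "l \<in> {x, y, z}" "m \<in> {x, y, z}" "l \<noteq> m" for l m
    using not_two_fixed[of l m] not_two_swapped[of l m] that xyz unfolding fixed_def swapped_def by blast+
  ultimately show False using xyz(10-12) by (metis insertI1 insertI2)
qed

text \<open>A sign flip at \<open>f\<close> keeps the star at \<open>a\<close>, so the change it
  causes, a nonzero multiple of column \<open>f\<close>, is supported on the edges at
  \<open>a\<close>.\<close>

lemma lin_aut_star_index:
  assumes A: "lin_aut d n A" and "d \<ge> 1" "n \<ge> d + 3" and "j < n"
  shows "\<exists>a<n. mat_app n A (star_vec n j) \<in> star n a \<and>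
     (\<forall>f\<in>edges n. j \<in> f \<longrightarrow> (\<forall>e\<in>edges n. a \<notin> e \<longrightarrow> A e f = 0))"
proof -
  let ?u = "star_vec n j"
  note img = lin_aut_maps_star_to_star[OF A \<open>d \<ge> 1\<close> \<open>n \<ge> d + 3\<close> _ \<open>j < n\<close>]
  obtain a where a: "a < n" "mat_app n A ?u \<in> star n a" using img[OF star_vec_in_star] by blast
  have "A e f = 0" if f: "f \<in> edges n" "j \<in> f" and e: "e \<in> edges n" "a \<notin> e" for e f
  proof -
    obtain k where k: "f = {j, k}" "k < n" "k \<noteq> j" using edges_containE[OF f] .
    obtain b where b: "b < n" "mat_app n A (?u(f := - ?u f)) \<in> star n b"
      using img[OF flip_in_star[OF star_vec_in_star]] by blast
    have "a = b"
    proof (cases "d = 1")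
      case True
      with A have "lin_aut 1 n A" by simp
      then show ?thesis
        by (rule flip_preserves_star_dim_1[OF _ _ star_vec_in_star \<open>j < n\<close> k(2,3) a(2) b(2)[unfolded k(1)] a(1) b(1)])
           (use \<open>n \<ge> d + 3\<close> in simp)
    next
      case False
      with \<open>d \<ge> 1\<close> \<open>n \<ge> d + 3\<close> have "n \<ge> 5" by simp
      then show ?thesis
        by (rule flip_preserves_star_dim_ge_2[OF A \<open>d \<ge> 1\<close> \<open>n \<ge> d + 3\<close> _ star_vec_in_star \<open>j < n\<close> k(2,3) a(2)
              b(2)[unfolded k(1)] a(1) b(1)])
    qed
    then have "2 * ?u f * mat_app n A (edge_vec f) e = 0"
      using mat_app_flip[of n A ?u f e] star_zero[OF a(2) e(2)] star_zero[OF b(2), of e] e by simp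
    then show ?thesis using f e by (simp add: star_vec_def mat_app_edge_vec)
  qed
  then show ?thesis using a by blast
qed

section \<open>Assembling the vertex permutation, the scalar and the signs\<close>

theorem theorem5p2:
  fixes d n :: nat and A :: "nat set \<Rightarrow> nat set \<Rightarrow> complex"
  assumes "d \<ge> 1" and "n \<ge> d + 3" and "lin_aut d n A"
  shows "\<exists>(c::complex) (s::nat set \<Rightarrow> complex) \<sigma>. c \<noteq> 0 \<and>
           (\<forall>e\<in>edges n. s e = 1 \<or> s e = -1) \<and> \<sigma> permutes {..<n} \<and>
           (\<forall>e\<in>edges n. \<forall>f\<in>edges n.
              A e f = c * s e * (if e = \<sigma> ` f then 1 else 0))"
proof -
  obtain \<tau> where \<tau>: "\<And>j. j < n \<Longrightarrow> \<tau> j < n"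
    and \<tau>_star: "\<And>j. j < n \<Longrightarrow> mat_app n A (star_vec n j) \<in> star n (\<tau> j)"
    and \<tau>_0: "\<And>j e f. \<lbrakk>j < n; f \<in> edges n; j \<in> f; e \<in> edges n; \<tau> j \<notin> e\<rbrakk> \<Longrightarrow> A e f = 0"
    using lin_aut_star_index[OF assms(3,1,2)] by metis
  obtain B where B: "lin_aut d n B" "\<And>v. v \<in> cvec n \<Longrightarrow> mat_app n B (mat_app n A v) = v"
    using lin_aut_inverse[OF assms(3)] by metis
  obtain \<tau>' where \<tau>': "\<And>j. j < n \<Longrightarrow> \<tau>' j < n"
    and \<tau>'_0: "\<And>j e f. \<lbrakk>j < n; f \<in> edges n; j \<in> f; e \<in> edges n; \<tau>' j \<notin> e\<rbrakk> \<Longrightarrow> B e f = 0"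
    using lin_aut_star_index[OF B(1) assms(1,2)] by metis
  have inv: "\<tau>' (\<tau> j) = j" if j: "j < n" for j
  proof -
    \<comment> \<open>The diagonal entry of \<open>B\<close> times \<open>A\<close> at
      \<open>{j, k}\<close> is 1. A nonzero term at \<open>g\<close> needs \<open>\<tau> j\<close>
      in \<open>g\<close>, and then \<open>\<tau>' (\<tau> j)\<close> in \<open>{j, k}\<close>.
      Varying \<open>k\<close> leaves only \<open>j\<close>.\<close>
    have mem: "\<tau>' (\<tau> j) \<in> {j, k}" if k: "k < n" "k \<noteq> j" for k
    proof (rule ccontr)
      assume no: "\<tau>' (\<tau> j) \<notin> {j, k}"
      have f: "{j, k} \<in> edges n" using j k by simp
      have z: "B {j, k} g * mat_app n A (edge_vec {j, k}) g = 0" if g: "g \<in> edges n" for g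
        using \<tau>_0[OF j f _ g] \<tau>'_0[OF \<tau>[OF j] g _ f] no g f by (auto simp: mat_app_edge_vec)
      have "(\<Sum>g\<in>edges n. B {j, k} g * mat_app n A (edge_vec {j, k}) g) = 0"
        by (rule sum.neutral) (use z in blast)
      then have "mat_app n B (mat_app n A (edge_vec {j, k})) {j, k} = 0"
        using f by (simp add: mat_app_def[of n B])
      moreover have "edge_vec {j, k} \<in> cvec n" using f by (auto simp: cvec_def edge_vec_def)
      ultimately show False using B(2) by (simp add: edge_vec_def)
    qed
    have "\<not> {..<n} \<subseteq> {j, \<tau>' (\<tau> j)}"
      using assms(1,2) card_mono[of "{j, \<tau>' (\<tau> j)}" "{..<n}"] card_length[of "[j, \<tau>' (\<tau> j)]"] by auto
    then obtain k where "k < n" "k \<noteq> j" "k \<noteq> \<tau>' (\<tau> j)" by auto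
    then show ?thesis using mem[of k] by auto
  qed
  define \<sigma> where "\<sigma> = (\<lambda>x. if x < n then \<tau> x else x)"
  have inj: "inj_on \<sigma> {..<n}"
    using inv by (intro inj_on_inverseI[of _ \<tau>']) (simp add: \<sigma>_def)
  have "\<sigma> ` {..<n} = {..<n}"
    by (rule endo_inj_surj) (use inj \<tau> in \<open>auto simp: \<sigma>_def\<close>)
  then have "bij_betw \<sigma> {..<n} {..<n}" using inj by (simp add: bij_betw_def)
  then have perm: "\<sigma> permutes {..<n}" by (rule bij_imp_permutes) (simp add: \<sigma>_def)
  have edge: "\<sigma> ` f \<in> edges n" if f: "f \<in> edges n" for f
  proof -
    obtain j k where jk: "f = {j, k}" "j < n" "k < n" "j \<noteq> k" using edgesE[OF f] .
    then have "\<sigma> j \<noteq> \<sigma> k" using inj_on_eq_iff[OF inj] by simp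
    then show ?thesis using jk \<tau> by (simp add: \<sigma>_def)
  qed
  \<comment> \<open>Column \<open>f = {j, k}\<close> is supported on the edges containing both
    \<open>\<tau> j\<close> and \<open>\<tau> k\<close>, and there is only one.\<close>
  have zero: "A e f = 0" if e: "e \<in> edges n" and f: "f \<in> edges n" and ne: "e \<noteq> \<sigma> ` f" for e f
  proof (rule ccontr)
    assume nz: "A e f \<noteq> 0"
    obtain j k where jk: "f = {j, k}" "j < n" "k < n" "j \<noteq> k" using edgesE[OF f] .
    then have "\<tau> j \<in> e" "\<tau> k \<in> e" "\<tau> j \<noteq> \<tau> k" using \<tau>_0[of j f e] \<tau>_0[of k f e] inv[of j] inv[of k] e f nz by auto
    then have "e = {\<tau> j, \<tau> k}" using e by (auto elim!: edgesE)
    then show False using ne jk by (simp add: \<sigma>_def)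
  qed
  have val: "mat_app n A (star_vec n j) (\<sigma> ` f) = A (\<sigma> ` f) f" if f: "f \<in> edges n" "j \<in> f" for f j
  proof -
    have "A (\<sigma> ` f) g * star_vec n j g = 0" if g: "g \<in> edges n - {f}" for g
    proof -
      have "\<sigma> ` f \<noteq> \<sigma> ` g" using g permutes_inj[OF perm] by (auto simp: inj_image_eq_iff)
      then show ?thesis using zero[OF edge[OF f(1)]] g by simp
    qed
    then have "(\<Sum>g\<in>edges n. A (\<sigma> ` f) g * star_vec n j g) = (\<Sum>g\<in>{f}. A (\<sigma> ` f) g * star_vec n j g)"
      using f by (intro sum.mono_neutral_right) auto
    then show ?thesis using f edge[OF f(1)] by (simp add: mat_app_def star_vec_def)
  qed
  have "\<exists>c. c \<noteq> 0 \<and> (\<forall>f\<in>edges n. j \<in> f \<longrightarrow> (A (\<sigma> ` f) f)\<^sup>2 = c\<^sup>2)" if j: "j < n" for j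
  proof -
    obtain c where c: "c \<noteq> 0"
      "\<And>e. e \<in> edges n \<Longrightarrow> (mat_app n A (star_vec n j) e)\<^sup>2 = (if \<tau> j \<in> e then c\<^sup>2 else 0)"
      using \<tau>_star[OF j] by (auto simp: star_def)
    have \<sigma>j: "\<sigma> j = \<tau> j" using j by (simp add: \<sigma>_def)
    have "(A (\<sigma> ` f) f)\<^sup>2 = c\<^sup>2" if f: "f \<in> edges n" "j \<in> f" for f
      using c(2)[OF edge[OF f(1)]] imageI[OF f(2), of \<sigma>, unfolded \<sigma>j] by (simp add: val[OF f])
    then show ?thesis using c(1) by blast
  qed
  then obtain C where C: "\<And>j. j < n \<Longrightarrow> C j \<noteq> 0"
    "\<And>j f. j < n \<Longrightarrow> f \<in> edges n \<Longrightarrow> j \<in> f \<Longrightarrow> (A (\<sigma> ` f) f)\<^sup>2 = (C j)\<^sup>2"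
    by metis
  define c where "c = C 0"
  have n0: "0 < n" using assms(2) by simp
  \<comment> \<open>The edge \<open>{0, j}\<close> lies in the stars of both 0 and \<open>j\<close>,
    so all stars share one scale up to sign.\<close>
  have Cc: "(C j)\<^sup>2 = c\<^sup>2" if "j < n" for j
  proof (cases "j = 0")
    case False
    then show ?thesis
      using C(2)[OF that, of "{0, j}"] C(2)[OF n0, of "{0, j}"] that n0 by (simp add: c_def)
  qed (simp add: c_def)
  have sq: "(A (\<sigma> ` f) f)\<^sup>2 = c\<^sup>2" if f: "f \<in> edges n" for f
  proof -
    obtain j k where "f = {j, k}" "j < n" using edgesE[OF f] by metis
    then show ?thesis using C(2)[of j f] Cc[of j] f by simp
  qed
  \<comment> \<open>The vimage under the permutation inverts its action on edges; the signs are
    indexed by image edges, as the order of the factors \<open>S P\<close> demands.\<close>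
  define s where "s = (\<lambda>e. A e (\<sigma> -` e) / c)"
  have s: "s (\<sigma> ` f) = A (\<sigma> ` f) f / c" for f
    by (simp add: s_def inj_vimage_image_eq[OF permutes_inj[OF perm]])
  have c0: "c \<noteq> 0" using C(1)[OF n0] by (simp add: c_def)
  have pm: "s e = 1 \<or> s e = -1" if e: "e \<in> edges n" for e
  proof -
    obtain x y where xy: "e = {x, y}" "x < n" "y < n" "x \<noteq> y" using edgesE[OF e] .
    then have "x \<in> \<sigma> ` {..<n}" "y \<in> \<sigma> ` {..<n}" using permutes_image[OF perm] by auto
    then obtain j k where jk: "x = \<sigma> j" "y = \<sigma> k" "j < n" "k < n" by blast
    then have "{j, k} \<in> edges n" "e = \<sigma> ` {j, k}" using xy by auto
    then have "(s e)\<^sup>2 = 1" using sq[of "{j, k}"] c0 by (simp only: s power_divide) simp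
    then show ?thesis by (simp add: power2_eq_1_iff)
  qed
  have "A e f = c * s e * (if e = \<sigma> ` f then 1 else 0)" if "e \<in> edges n" "f \<in> edges n" for e f
    using zero[OF that] c0 by (simp add: s)
  then show ?thesis using c0 pm perm by blast
qed

end
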